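(* Let $A$ be a positive self-adjoint operator on $L^2(X,\mu)$ whose spectral projections $\Pi_\lambda=\chi_A(]0,\lambda])$ are ultracontractive, i.e. $F(\lambda)=\|\Pi_\lambda\|_{1,\infty}<+\infty$ for all $\lambda$. Suppose moreover that the Stieltjes integral $G(\lambda)=\int_0^\lambda \frac{dF(u)}{u}$ converges. Then every non-zero $f\in L^2(X)\cap(\ker A)^\perp$, of energy $\mathcal{E}(f)=\langle Af,f\rangle_2$, satisfies $$\int_X H\Bigl(\frac{|f(x)|^2}{4\,\mathcal{E}(f)}\Bigr)\,d\mu(x)\le 1,$$ where $H(y)=y\,G^{-1}(y)$.
   Context: $(X,\mu)$ is a $\sigma$-finite measure space. A positive self-adjoint operator $A$ is a (possibly unbounded) self-adjoint operator with $\langle Af,f\rangle\ge 0$; $\chi_A(I)$ denotes its spectral projection on the interval $I$, and $]0,\lambda]=(0,\lambda]$. $\|P\|_{1,\infty}$ is the norm of $P$ as an operator from $L^1$ to $L^\infty$ (an operator is ultracontractive if this is finite). $F(0)=0$. The Stieltjes integral is understood through integration by parts: $G(\lambda)=\lambda^{-1}F(\lambda)+\int_0^\lambda u^{-2}F(u)\,du$ (convergence meaning that this is finite). $G^{-1}$ is the right continuous inverse: $G^{-1}(y)=\sup\{\lambda\mid G(\lambda)\le y\}\in[0,+\infty]$. The energy is $\mathcal{E}(f)=\|A^{1/2}f\|_2^2\in[0,+\infty]$. *)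

theory Defs
  imports "HOL-Analysis.Analysis" "HOL-Probability.Essential_Supremum"
begin

section \<open>The Hilbert space of square-integrable functions\<close>

text \<open>
  Elements of complex \<open>L\<^sup>2\<close> are handled through representatives: equality in the Hilbert
  space is equality almost everywhere, and every notion below is invariant under it.
\<close>

definition L2 :: "'a measure \<Rightarrow> ('a \<Rightarrow> complex) set" where
  "L2 M = {f \<in> borel_measurable M. integrable M (\<lambda>x. (cmod (f x))\<^sup>2)}"

definition eq_ae :: "'a measure \<Rightarrow> ('a \<Rightarrow> complex) \<Rightarrow> ('a \<Rightarrow> complex) \<Rightarrow> bool" where
  "eq_ae M f g \<longleftrightarrow> (AE x in M. f x = g x)"

definition L2_inner :: "'a measure \<Rightarrow> ('a \<Rightarrow> complex) \<Rightarrow> ('a \<Rightarrow> complex) \<Rightarrow> complex" where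
  "L2_inner M f g = (LINT x|M. f x * cnj (g x))"

definition L2_norm :: "'a measure \<Rightarrow> ('a \<Rightarrow> complex) \<Rightarrow> real" where
  "L2_norm M f = sqrt (LINT x|M. (cmod (f x))\<^sup>2)"


section \<open>Unbounded self-adjoint operators\<close>

text \<open>
  An unbounded operator is given by its graph, saturated under almost-everywhere equality:
  \<open>(f, g) \<in> A\<close> means that \<open>f\<close> lies in the domain of \<open>A\<close> and \<open>A f = g\<close>.
\<close>

type_synonym 'a operator = "(('a \<Rightarrow> complex) \<times> ('a \<Rightarrow> complex)) set"

definition linear_operator :: "'a measure \<Rightarrow> 'a operator \<Rightarrow> bool" where
  "linear_operator M A \<longleftrightarrow>
     A \<subseteq> L2 M \<times> L2 M \<and>
     (\<lambda>x. 0, \<lambda>x. 0) \<in> A \<and>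
     (\<forall>f g f' g' a b. (f, g) \<in> A \<longrightarrow> (f', g') \<in> A \<longrightarrow>
        (\<lambda>x. a * f x + b * f' x, \<lambda>x. a * g x + b * g' x) \<in> A) \<and>
     (\<forall>f g. \<forall>f'\<in>L2 M. \<forall>g'\<in>L2 M.
        (f, g) \<in> A \<longrightarrow> eq_ae M f f' \<longrightarrow> eq_ae M g g' \<longrightarrow> (f', g') \<in> A) \<and>
     (\<forall>f g g'. (f, g) \<in> A \<longrightarrow> (f, g') \<in> A \<longrightarrow> eq_ae M g g')"

definition densely_defined :: "'a measure \<Rightarrow> 'a operator \<Rightarrow> bool" where
  "densely_defined M A \<longleftrightarrow>
     (\<forall>f\<in>L2 M. \<forall>e>0. \<exists>g\<in>Domain A. L2_norm M (\<lambda>x. f x - g x) < e)"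

definition adjoint_operator :: "'a measure \<Rightarrow> 'a operator \<Rightarrow> 'a operator" where
  "adjoint_operator M A =
     {(g, h). g \<in> L2 M \<and> h \<in> L2 M \<and> (\<forall>(f, k)\<in>A. L2_inner M k g = L2_inner M f h)}"

definition self_adjoint :: "'a measure \<Rightarrow> 'a operator \<Rightarrow> bool" where
  "self_adjoint M A \<longleftrightarrow>
     linear_operator M A \<and> densely_defined M A \<and> adjoint_operator M A = A"

text \<open>For self-adjoint \<open>A\<close> the number \<open>\<langle>A f, f\<rangle>\<close> is real, so taking the real part loses nothing.\<close>

definition positive_operator :: "'a measure \<Rightarrow> 'a operator \<Rightarrow> bool" where
  "positive_operator M A \<longleftrightarrow> (\<forall>(f, g)\<in>A. 0 \<le> Re (L2_inner M g f))"

definition orth_kernel :: "'a measure \<Rightarrow> 'a operator \<Rightarrow> ('a \<Rightarrow> complex) set" where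
  "orth_kernel M A = {f \<in> L2 M. \<forall>g. (g, \<lambda>x. 0) \<in> A \<longrightarrow> L2_inner M f g = 0}"


section \<open>Spectral projections\<close>

definition orth_projection :: "'a measure \<Rightarrow> (('a \<Rightarrow> complex) \<Rightarrow> ('a \<Rightarrow> complex)) \<Rightarrow> bool" where
  "orth_projection M P \<longleftrightarrow>
     (\<forall>f\<in>L2 M. P f \<in> L2 M) \<and>
     (\<forall>f\<in>L2 M. \<forall>g\<in>L2 M. eq_ae M f g \<longrightarrow> eq_ae M (P f) (P g)) \<and>
     (\<forall>f\<in>L2 M. \<forall>g\<in>L2 M. \<forall>a b.
        eq_ae M (P (\<lambda>x. a * f x + b * g x)) (\<lambda>x. a * P f x + b * P g x)) \<and>
     (\<forall>f\<in>L2 M. eq_ae M (P (P f)) (P f)) \<and>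
     (\<forall>f\<in>L2 M. \<forall>g\<in>L2 M. L2_inner M (P f) g = L2_inner M f (P g))"

text \<open>Only the values of \<open>E\<close> on Borel sets matter; countable additivity is in the strong sense.\<close>

definition projection_valued_measure ::
    "'a measure \<Rightarrow> (real set \<Rightarrow> ('a \<Rightarrow> complex) \<Rightarrow> ('a \<Rightarrow> complex)) \<Rightarrow> bool" where
  "projection_valued_measure M E \<longleftrightarrow>
     (\<forall>B\<in>sets borel. orth_projection M (E B)) \<and>
     (\<forall>f\<in>L2 M. eq_ae M (E {} f) (\<lambda>x. 0) \<and> eq_ae M (E UNIV f) f) \<and>
     (\<forall>B\<in>sets borel. \<forall>C\<in>sets borel. \<forall>f\<in>L2 M. eq_ae M (E (B \<inter> C) f) (E B (E C f))) \<and>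
     (\<forall>B. range B \<subseteq> sets borel \<longrightarrow> disjoint_family B \<longrightarrow>
        (\<forall>f\<in>L2 M.
           (\<lambda>n. L2_norm M (\<lambda>x. E (\<Union>i. B i) f x - (\<Sum>i<n. E (B i) f x))) \<longlonglongrightarrow> 0))"

text \<open>The scalar measure \<open>B \<mapsto> \<langle>E(B) f, f\<rangle> = \<parallel>E(B) f\<parallel>\<^sup>2\<close>.\<close>

definition scalar_spectral_measure ::
    "'a measure \<Rightarrow> (real set \<Rightarrow> ('a \<Rightarrow> complex) \<Rightarrow> ('a \<Rightarrow> complex)) \<Rightarrow> ('a \<Rightarrow> complex) \<Rightarrow> real measure"
  where
  "scalar_spectral_measure M E f =
     measure_of UNIV (sets borel) (\<lambda>B. ennreal ((L2_norm M (E B f))\<^sup>2))"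

definition spectral_domain ::
    "'a measure \<Rightarrow> (real set \<Rightarrow> ('a \<Rightarrow> complex) \<Rightarrow> ('a \<Rightarrow> complex)) \<Rightarrow> (real \<Rightarrow> real) \<Rightarrow> ('a \<Rightarrow> complex) set"
  where
  "spectral_domain M E \<phi> =
     {f \<in> L2 M. (\<integral>\<^sup>+ t. ennreal ((\<phi> t)\<^sup>2) \<partial>(scalar_spectral_measure M E f)) < \<infinity>}"

text \<open>
  The integral of \<open>\<phi>\<close> against the complex measure \<open>B \<mapsto> \<langle>E(B) f, h\<rangle>\<close>, which is written as
  a combination of four positive measures by polarization.
\<close>

definition spectral_form ::
    "'a measure \<Rightarrow> (real set \<Rightarrow> ('a \<Rightarrow> complex) \<Rightarrow> ('a \<Rightarrow> complex)) \<Rightarrow> (real \<Rightarrow> real) \<Rightarrow>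
     ('a \<Rightarrow> complex) \<Rightarrow> ('a \<Rightarrow> complex) \<Rightarrow> complex" where
  "spectral_form M E \<phi> f h =
     (\<Sum>k<4. \<i> ^ k *
        complex_of_real (LINT t|scalar_spectral_measure M E (\<lambda>x. f x + \<i> ^ k * h x). \<phi> t)) / 4"

text \<open>
  The operator \<open>\<integral> \<phi>(t) dE(t)\<close>, on its domain of those \<open>f\<close> with
  \<open>\<integral> \<phi>(t)\<^sup>2 d\<langle>E(t) f, f\<rangle> < \<infinity>\<close>. That domain is dense, so testing against it
  determines the value almost everywhere.
\<close>

definition spectral_integral ::
    "'a measure \<Rightarrow> (real set \<Rightarrow> ('a \<Rightarrow> complex) \<Rightarrow> ('a \<Rightarrow> complex)) \<Rightarrow> (real \<Rightarrow> real) \<Rightarrow> 'a operator"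
  where
  "spectral_integral M E \<phi> =
     {(f, g). f \<in> spectral_domain M E \<phi> \<and> g \<in> L2 M \<and>
        (\<forall>h\<in>spectral_domain M E \<phi>. L2_inner M g h = spectral_form M E \<phi> f h)}"

text \<open>
  \<open>E\<close> is the spectral measure of \<open>A\<close>, i.e. \<open>E B = \<chi>\<^sub>A(B)\<close>: by the spectral
  theorem every self-adjoint \<open>A\<close> has one, and it is unique up to almost-everywhere equality.
\<close>

definition spectral_resolution ::
    "'a measure \<Rightarrow> 'a operator \<Rightarrow> (real set \<Rightarrow> ('a \<Rightarrow> complex) \<Rightarrow> ('a \<Rightarrow> complex)) \<Rightarrow> bool" where
  "spectral_resolution M A E \<longleftrightarrow>
     projection_valued_measure M E \<and> A = spectral_integral M E (\<lambda>t. t)"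

text \<open>
  \<open>\<parallel>A\<^sup>1\<^sup>/\<^sup>2 f\<parallel>\<^sup>2\<close>, which is \<open>\<infinity>\<close> (an infimum over the empty set) when \<open>f\<close> is not in the domain
  of \<open>A\<^sup>1\<^sup>/\<^sup>2\<close>; otherwise the infimum ranges over representatives of one element. The values of
  \<open>sqrt\<close> at negative arguments are irrelevant because the spectrum of a positive \<open>A\<close> lies
  in \<open>[0, \<infinity>)\<close>.
\<close>

definition energy ::
    "'a measure \<Rightarrow> (real set \<Rightarrow> ('a \<Rightarrow> complex) \<Rightarrow> ('a \<Rightarrow> complex)) \<Rightarrow> ('a \<Rightarrow> complex) \<Rightarrow> ennreal"
  where
  "energy M E f = (INF g\<in>{g. (f, g) \<in> spectral_integral M E sqrt}. ennreal ((L2_norm M g)\<^sup>2))"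


section \<open>Ultracontractivity and the associated functions\<close>

text \<open>
  The norm from \<open>L\<^sup>1\<close> to \<open>L\<^sup>\<infinity>\<close> of an operator on \<open>L\<^sup>2\<close> is taken on the dense subspace
  \<open>L\<^sup>1 \<inter> L\<^sup>2\<close> of \<open>L\<^sup>1\<close>.
\<close>

definition norm_L1_Linf :: "'a measure \<Rightarrow> (('a \<Rightarrow> complex) \<Rightarrow> ('a \<Rightarrow> complex)) \<Rightarrow> ennreal" where
  "norm_L1_Linf M P =
     (SUP f\<in>{f \<in> L2 M. integrable M f \<and> (LINT x|M. cmod (f x)) \<le> 1}.
        esssup M (\<lambda>x. ennreal (cmod (P f x))))"

definition spectral_F ::
    "'a measure \<Rightarrow> (real set \<Rightarrow> ('a \<Rightarrow> complex) \<Rightarrow> ('a \<Rightarrow> complex)) \<Rightarrow> real \<Rightarrow> ennreal" where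
  "spectral_F M E l = norm_L1_Linf M (E {0<..l})"

text \<open>The Stieltjes integral \<open>\<integral> dF(u)/u\<close> over \<open>(0, l]\<close>, read through integration by parts.\<close>

definition stieltjes_G :: "(real \<Rightarrow> ennreal) \<Rightarrow> real \<Rightarrow> ennreal" where
  "stieltjes_G F l =
     ennreal (1 / l) * F l + (\<integral>\<^sup>+ u\<in>{0<..l}. ennreal (1 / u\<^sup>2) * F u \<partial>lborel)"

definition right_inverse :: "(real \<Rightarrow> ennreal) \<Rightarrow> ennreal \<Rightarrow> ennreal" where
  "right_inverse G y = Sup {ennreal l | l. 0 \<le> l \<and> G l \<le> y}"

definition H_fun :: "(real \<Rightarrow> ennreal) \<Rightarrow> ennreal \<Rightarrow> ennreal" where
  "H_fun G y = y * right_inverse G y"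

end

theory Submission imports Defs begin

text \<open>
  Let \<open>\<mu>\<^sub>f\<close> be the scalar spectral measure of \<open>f\<close> and let \<open>e\<close> be the energy of \<open>f\<close>, which is
  finite without loss of generality and at least \<open>\<integral> t d\<mu>\<^sub>f(t)\<close>. The weighted Cauchy--Schwarz
  inequality in the spectral variable gives \<open>\<bar>\<langle>\<Pi>\<^sub>\<lambda> f, g\<rangle>\<bar>\<^sup>2 \<le> e \<cdot> \<langle>A\<^sup>-\<^sup>1 \<Pi>\<^sub>\<lambda> g, g\<rangle>\<close>, and
  integrating by parts, with \<open>\<mu>\<^sub>g(]0, u]) \<le> F(u)\<close> for \<open>\<parallel>g\<parallel>\<^sub>1 \<le> 1\<close>, bounds the last
  factor by \<open>G(\<lambda>)\<close>. By duality \<open>\<bar>\<Pi>\<^sub>\<lambda> f\<bar>\<^sup>2 \<le> e G(\<lambda>)\<close> almost everywhere, so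
  wherever \<open>4 e G(\<lambda>) \<le> \<bar>f\<bar>\<^sup>2\<close> the tail satisfies \<open>\<bar>f - \<Pi>\<^sub>\<lambda> f\<bar> \<ge> \<bar>f\<bar> / 2\<close>.
  Integrating \<open>\<bar>f - \<Pi>\<^sub>\<lambda> f\<bar>\<^sup>2\<close> over \<open>X\<close> and then over \<open>\<lambda>\<close> gives at most \<open>e\<close> by the layer cake
  formula, whereas the set of such \<open>\<lambda>\<close> has length at least \<open>G\<^sup>-\<^sup>1(\<bar>f\<bar>\<^sup>2 / 4e)\<close>.
  The integral over \<open>\<lambda>\<close> is replaced by Riemann sums and Fatou's lemma, because
  \<open>(x, \<lambda>) \<mapsto> \<Pi>\<^sub>\<lambda> f(x)\<close> need not be jointly measurable for the chosen representatives.
\<close>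

section \<open>Square-integrable functions\<close>

lemma L2_measurable [measurable_dest]: "f \<in> L2 M \<Longrightarrow> f \<in> borel_measurable M"
  by (simp add: L2_def)

lemma L2_integrable_power2: "f \<in> L2 M \<Longrightarrow> integrable M (\<lambda>x. (cmod (f x))\<^sup>2)"
  by (simp add: L2_def)

lemma borel_measurable_cnj [measurable]:
  "f \<in> borel_measurable M \<Longrightarrow> (\<lambda>x. cnj (f x)) \<in> borel_measurable M"
  by (rule measurable_compose[OF _ borel_measurable_continuous_onI])
    (auto intro: continuous_intros)

lemma L2_integrable_mult:
  assumes [measurable]: "f \<in> L2 M" "g \<in> L2 M"
  shows "integrable M (\<lambda>x. f x * cnj (g x))"
proof (rule Bochner_Integration.integrable_bound)
  show "integrable M (\<lambda>x. (cmod (f x))\<^sup>2 + (cmod (g x))\<^sup>2)"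
    using assms by (intro Bochner_Integration.integrable_add L2_integrable_power2)
  have "a * b \<le> a\<^sup>2 + b\<^sup>2" if "0 \<le> a" "0 \<le> b" for a b :: real
    using sum_squares_bound[of a b] mult_nonneg_nonneg[OF that] by linarith
  then show "AE x in M. norm (f x * cnj (g x)) \<le> norm ((cmod (f x))\<^sup>2 + (cmod (g x))\<^sup>2)"
    by (auto simp: norm_mult)
qed measurable

lemma cmod_add_power2_le: "(cmod (a + b))\<^sup>2 \<le> 2 * (cmod a)\<^sup>2 + 2 * (cmod b)\<^sup>2"
proof -
  have "(cmod (a + b))\<^sup>2 \<le> (cmod a + cmod b)\<^sup>2"
    by (intro power_mono norm_triangle_ineq) auto
  also have "\<dots> \<le> 2 * (cmod a)\<^sup>2 + 2 * (cmod b)\<^sup>2"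
    using sum_squares_bound[of "cmod a" "cmod b"] by (simp add: power2_sum)
  finally show ?thesis .
qed

lemma L2_lincomb:
  assumes [measurable]: "f \<in> L2 M" "g \<in> L2 M"
  shows "(\<lambda>x. a * f x + b * g x) \<in> L2 M"
proof -
  have "integrable M (\<lambda>x. (cmod (a * f x + b * g x))\<^sup>2)"
  proof (rule Bochner_Integration.integrable_bound)
    show "integrable M (\<lambda>x. 2 * (cmod a)\<^sup>2 * (cmod (f x))\<^sup>2 + 2 * (cmod b)\<^sup>2 * (cmod (g x))\<^sup>2)"
      using assms
      by (intro Bochner_Integration.integrable_add integrable_mult_right L2_integrable_power2)
    show "AE x in M. norm ((cmod (a * f x + b * g x))\<^sup>2)
        \<le> norm (2 * (cmod a)\<^sup>2 * (cmod (f x))\<^sup>2 + 2 * (cmod b)\<^sup>2 * (cmod (g x))\<^sup>2)"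
    proof (rule AE_I2)
      fix x
      show "norm ((cmod (a * f x + b * g x))\<^sup>2)
        \<le> norm (2 * (cmod a)\<^sup>2 * (cmod (f x))\<^sup>2 + 2 * (cmod b)\<^sup>2 * (cmod (g x))\<^sup>2)"
        using cmod_add_power2_le[of "a * f x" "b * g x"]
        by (simp add: norm_mult power_mult_distrib mult.assoc)
    qed
  qed measurable
  then show ?thesis
    by (simp add: L2_def)
qed

lemma L2_zero: "(\<lambda>x. 0) \<in> L2 M"
  by (simp add: L2_def)

lemma L2_add_scaled: "f \<in> L2 M \<Longrightarrow> g \<in> L2 M \<Longrightarrow> (\<lambda>x. f x + c * g x) \<in> L2 M"
  using L2_lincomb[of f M g 1 c] by simp

lemma L2_diff: "f \<in> L2 M \<Longrightarrow> g \<in> L2 M \<Longrightarrow> (\<lambda>x. f x - g x) \<in> L2 M"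
  using L2_lincomb[of f M g 1 "-1"] by simp

lemma L2_sum: "(\<And>i. i \<in> I \<Longrightarrow> f i \<in> L2 M) \<Longrightarrow> (\<lambda>x. \<Sum>i\<in>I. f i x) \<in> L2 M"
proof (induction I rule: infinite_finite_induct)
  case (insert i I)
  then show ?case
    using L2_lincomb[of "f i" M "\<lambda>x. \<Sum>i\<in>I. f i x" 1 1] by simp
qed (auto intro: L2_zero)

lemma L2_inner_lincomb:
  assumes "f \<in> L2 M" "g \<in> L2 M" "h \<in> L2 M"
  shows "L2_inner M (\<lambda>x. a * f x + b * g x) h = a * L2_inner M f h + b * L2_inner M g h"
  using L2_integrable_mult[OF assms(1,3)] L2_integrable_mult[OF assms(2,3)]
  by (simp add: L2_inner_def distrib_right mult.assoc)

lemma L2_inner_commute: "L2_inner M g f = cnj (L2_inner M f g)"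
  unfolding L2_inner_def by (subst Bochner_Integration.integral_cnj[symmetric]) (simp add: mult.commute)

lemma L2_inner_self: "L2_inner M f f = complex_of_real ((L2_norm M f)\<^sup>2)"
proof -
  have "L2_inner M f f = (LINT x|M. complex_of_real ((cmod (f x))\<^sup>2))"
    by (simp only: L2_inner_def complex_norm_square)
  also have "\<dots> = complex_of_real (LINT x|M. (cmod (f x))\<^sup>2)"
    by (rule integral_complex_of_real)
  finally show ?thesis
    by (simp add: L2_norm_def del: of_real_power)
qed

lemma L2_norm_nonneg: "0 \<le> L2_norm M f"
  by (simp add: L2_norm_def)

lemma L2_inner_sum:
  assumes "\<And>i. i \<in> I \<Longrightarrow> f i \<in> L2 M" "h \<in> L2 M"
  shows "L2_inner M (\<lambda>x. \<Sum>i\<in>I. f i x) h = (\<Sum>i\<in>I. L2_inner M (f i) h)"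
  using assms by (simp add: L2_inner_def sum_distrib_right L2_integrable_mult)

lemma L2_inner_diff:
  assumes "f \<in> L2 M" "g \<in> L2 M" "h \<in> L2 M"
  shows "L2_inner M (\<lambda>x. f x - g x) h = L2_inner M f h - L2_inner M g h"
  using L2_inner_lincomb[OF assms, of 1 "-1"] by simp

lemma L2_norm_add_scaled:
  assumes "f \<in> L2 M" "g \<in> L2 M"
  shows "(L2_norm M (\<lambda>x. f x + c * g x))\<^sup>2 =
    (L2_norm M f)\<^sup>2 + 2 * Re (cnj c * L2_inner M f g) + (cmod c)\<^sup>2 * (L2_norm M g)\<^sup>2"
proof -
  let ?h = "\<lambda>x. f x + c * g x"
  have h: "?h \<in> L2 M"
    by (intro L2_add_scaled assms)
  have *: "L2_inner M ?h k = L2_inner M f k + c * L2_inner M g k" if "k \<in> L2 M" for k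
    using L2_inner_lincomb[OF assms that, of 1 c] by simp
  have "L2_inner M ?h ?h = cnj (L2_inner M ?h f) + c * cnj (L2_inner M ?h g)"
    by (subst *[OF h]) (simp add: L2_inner_commute[of M f ?h] L2_inner_commute[of M g ?h])
  also have "\<dots> = cnj (L2_inner M f f) + (cnj c * L2_inner M f g
      + cnj (cnj c * L2_inner M f g)) + c * cnj c * cnj (L2_inner M g g)"
    by (simp add: * assms L2_inner_commute[of M g f] algebra_simps)
  finally have "Re (L2_inner M ?h ?h) = Re (L2_inner M f f) + 2 * Re (cnj c * L2_inner M f g)
     + Re (c * cnj c * cnj (L2_inner M g g))"
    by simp
  moreover have "c * cnj c = complex_of_real ((cmod c)\<^sup>2)"
    by (rule complex_norm_square[symmetric])
  ultimately show ?thesis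
    by (simp add: L2_inner_self del: of_real_power)
qed

lemma L2_norm_diff_power2:
  assumes "f \<in> L2 M" "g \<in> L2 M"
  shows "(L2_norm M (\<lambda>x. f x - g x))\<^sup>2 =
    (L2_norm M f)\<^sup>2 - 2 * Re (L2_inner M f g) + (L2_norm M g)\<^sup>2"
  using L2_norm_add_scaled[OF assms, of "-1"] by simp

lemma L2_norm_eq_0_iff:
  assumes "f \<in> L2 M"
  shows "L2_norm M f = 0 \<longleftrightarrow> eq_ae M f (\<lambda>x. 0)"
  unfolding L2_norm_def eq_ae_def
  using integral_nonneg_eq_0_iff_AE[OF L2_integrable_power2[OF assms]] by simp

lemma eq_ae_sym: "eq_ae M f g \<Longrightarrow> eq_ae M g f"
  by (auto simp: eq_ae_def)

lemma L2_inner_cong: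
  assumes [measurable]: "f \<in> L2 M" "f' \<in> L2 M" "g \<in> L2 M" "g' \<in> L2 M"
    and "eq_ae M f f'" "eq_ae M g g'"
  shows "L2_inner M f g = L2_inner M f' g'"
  unfolding L2_inner_def
  by (rule integral_cong_AE) (use assms in \<open>auto simp: eq_ae_def\<close>)

lemma L2_norm_cong:
  assumes [measurable]: "f \<in> L2 M" "f' \<in> L2 M"
    and "eq_ae M f f'"
  shows "L2_norm M f = L2_norm M f'"
  unfolding L2_norm_def
  by (rule arg_cong[where f=sqrt], rule integral_cong_AE) (use assms in \<open>auto simp: eq_ae_def\<close>)

lemma L2_Cauchy_Schwarz:
  assumes "f \<in> L2 M" "g \<in> L2 M"
  shows "cmod (L2_inner M f g) \<le> L2_norm M f * L2_norm M g"
proof (cases "L2_norm M g = 0")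
  case True
  then have "L2_inner M f g = L2_inner M f (\<lambda>x. 0)"
    using assms by (intro L2_inner_cong) (auto simp: L2_norm_eq_0_iff L2_zero eq_ae_def)
  then show ?thesis
    by (simp add: L2_inner_def True)
next
  case False
  let ?z = "L2_inner M f g" and ?n = "(L2_norm M g)\<^sup>2"
  have n: "?n > 0"
    using False by simp
  have z: "cnj ?z * ?z = complex_of_real ((cmod ?z)\<^sup>2)"
    by (subst complex_norm_square) (simp add: mult.commute)
  \<comment> \<open>This coefficient makes \<open>f + c * g\<close> orthogonal to \<open>g\<close>
    and so minimises its norm; the inequality says that the minimum is nonnegative.\<close>
  define c where "c = - ?z / of_real ?n"
  have "cnj c * ?z = - (cnj ?z * ?z) / of_real ?n"
    by (simp add: c_def)
  then have Re: "Re (cnj c * ?z) = - ((cmod ?z)\<^sup>2 / ?n)"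
    unfolding z
    by (simp only: of_real_minus[symmetric] of_real_divide[symmetric] Re_complex_of_real)
  have c: "(cmod c)\<^sup>2 * ?n = (cmod ?z)\<^sup>2 / ?n"
    using n by (simp add: c_def norm_divide power_divide norm_power power2_eq_square norm_mult)
  have "0 \<le> (L2_norm M f)\<^sup>2 - (cmod ?z)\<^sup>2 / ?n"
    using L2_norm_add_scaled[OF assms, of c, unfolded Re c]
      zero_le_power2[of "L2_norm M (\<lambda>x. f x + c * g x)"] by linarith
  then have "(cmod ?z)\<^sup>2 \<le> (L2_norm M f * L2_norm M g)\<^sup>2"
    using n by (simp add: field_simps power_mult_distrib)
  then show ?thesis
    by (rule power2_le_imp_le) (simp add: L2_norm_nonneg)
qed

section \<open>Scalar spectral measures\<close>

locale pvm =
  fixes M :: "'a measure" and E :: "real set \<Rightarrow> ('a \<Rightarrow> complex) \<Rightarrow> ('a \<Rightarrow> complex)"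
  assumes pvm: "projection_valued_measure M E"
begin

abbreviation \<mu> :: "('a \<Rightarrow> complex) \<Rightarrow> real measure" where
  "\<mu> f \<equiv> scalar_spectral_measure M E f"

lemma E_projection: "B \<in> sets borel \<Longrightarrow> orth_projection M (E B)"
  using pvm by (simp add: projection_valued_measure_def)

lemma E_L2: "B \<in> sets borel \<Longrightarrow> f \<in> L2 M \<Longrightarrow> E B f \<in> L2 M"
  using E_projection by (simp add: orth_projection_def)

lemma E_lincomb:
  "B \<in> sets borel \<Longrightarrow> f \<in> L2 M \<Longrightarrow> g \<in> L2 M \<Longrightarrow>
    eq_ae M (E B (\<lambda>x. a * f x + b * g x)) (\<lambda>x. a * E B f x + b * E B g x)"
  using E_projection by (simp add: orth_projection_def)

lemma E_symm:
  "B \<in> sets borel \<Longrightarrow> f \<in> L2 M \<Longrightarrow> g \<in> L2 M \<Longrightarrow> L2_inner M (E B f) g = L2_inner M f (E B g)"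
  using E_projection by (simp add: orth_projection_def)

lemma E_Int:
  "B \<in> sets borel \<Longrightarrow> C \<in> sets borel \<Longrightarrow> f \<in> L2 M \<Longrightarrow> eq_ae M (E (C \<inter> B) f) (E C (E B f))"
  using pvm by (simp add: projection_valued_measure_def)

lemma E_empty: "f \<in> L2 M \<Longrightarrow> eq_ae M (E {} f) (\<lambda>x. 0)"
  using pvm by (simp add: projection_valued_measure_def)

lemma E_UNIV: "f \<in> L2 M \<Longrightarrow> eq_ae M (E UNIV f) f"
  using pvm by (simp add: projection_valued_measure_def)

lemma E_UN:
  "range B \<subseteq> sets borel \<Longrightarrow> disjoint_family B \<Longrightarrow> f \<in> L2 M \<Longrightarrow>
    (\<lambda>n. L2_norm M (\<lambda>x. E (\<Union>i. B i) f x - (\<Sum>i<n. E (B i) f x))) \<longlonglongrightarrow> 0"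
  using pvm by (simp add: projection_valued_measure_def)

lemma E_add_scaled:
  assumes "B \<in> sets borel" "f \<in> L2 M" "g \<in> L2 M"
  shows "eq_ae M (E B (\<lambda>x. f x + c * g x)) (\<lambda>x. E B f x + c * E B g x)"
  using E_lincomb[OF assms, of 1 c] by simp

text \<open>Symmetry moves one projection across and multiplicativity merges the two. Disjoint sets
  thus give orthogonal pieces, and equal sets give a squared norm.\<close>

lemma inner_E_E:
  assumes [simp]: "B \<in> sets borel" "C \<in> sets borel" "f \<in> L2 M" "g \<in> L2 M"
  shows "L2_inner M (E B f) (E C g) = L2_inner M (E (C \<inter> B) f) g"
proof -
  have "L2_inner M (E B f) (E C g) = L2_inner M (E C (E B f)) g"
    by (rule E_symm[symmetric]) (simp_all add: E_L2)
  also have "\<dots> = L2_inner M (E (C \<inter> B) f) g"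
    by (rule L2_inner_cong) (auto intro!: E_L2 eq_ae_sym[OF E_Int] simp: eq_ae_def[of M g])
  finally show ?thesis .
qed

lemma inner_E_self:
  assumes "B \<in> sets borel" "f \<in> L2 M"
  shows "L2_inner M (E B f) f = complex_of_real ((L2_norm M (E B f))\<^sup>2)"
  using inner_E_E[OF assms(1,1) assms(2,2)] by (simp add: L2_inner_self)

lemma norm_E_le:
  assumes "B \<in> sets borel" "f \<in> L2 M"
  shows "L2_norm M (E B f) \<le> L2_norm M f"
proof (cases "L2_norm M (E B f) = 0")
  case False
  have "(L2_norm M (E B f))\<^sup>2 \<le> L2_norm M (E B f) * L2_norm M f"
    using L2_Cauchy_Schwarz[OF E_L2[OF assms] assms(2)]
    unfolding inner_E_self[OF assms] norm_of_real by simp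
  with False show ?thesis
    using L2_norm_nonneg[of M "E B f"] by (simp add: power2_eq_square)
qed (simp add: L2_norm_nonneg)

lemma norm_E_UNIV: "f \<in> L2 M \<Longrightarrow> L2_norm M (E UNIV f) = L2_norm M f"
  by (intro L2_norm_cong E_L2 E_UNIV) auto

lemma norm_E_empty: "f \<in> L2 M \<Longrightarrow> L2_norm M (E {} f) = 0"
  using E_empty[of f] E_L2[of "{}" f] by (simp add: L2_norm_eq_0_iff)

text \<open>Strong convergence of \<open>w n\<close> to \<open>v\<close> becomes convergence of
  squared norms by Pythagoras: both the inner product of \<open>v\<close> with \<open>w n\<close>
  and the squared norm of \<open>w n\<close> equal \<open>s n\<close>, so their squared distance is
  the squared norm of \<open>v\<close> minus \<open>s n\<close>.\<close>

lemma norm_E_sums: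
  assumes B: "range B \<subseteq> sets borel" "disjoint_family B" and f: "f \<in> L2 M"
  shows "(\<lambda>i. (L2_norm M (E (B i) f))\<^sup>2) sums (L2_norm M (E (\<Union>i. B i) f))\<^sup>2"
proof -
  let ?U = "\<Union>i. B i"
  have [simp]: "B i \<in> sets borel" for i
    using B by auto
  have U [simp]: "?U \<in> sets borel"
    by auto
  define v where "v = E ?U f"
  define w where "w n = (\<lambda>x. \<Sum>i<n. E (B i) f x)" for n :: nat
  define s where "s n = (\<Sum>i<n. (L2_norm M (E (B i) f))\<^sup>2)" for n :: nat
  have v: "v \<in> L2 M"
    by (simp add: v_def E_L2 f)
  have w: "w n \<in> L2 M" for n
    unfolding w_def by (intro L2_sum E_L2) (simp_all add: f)
  have inner_w: "L2_inner M (w n) (E C f) = s n" if "C \<in> sets borel" "\<And>i. i < n \<Longrightarrow> B i \<subseteq> C" for n C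
  proof -
    have "L2_inner M (w n) (E C f) = (\<Sum>i<n. L2_inner M (E (B i) f) (E C f))"
      unfolding w_def using that by (intro L2_inner_sum E_L2) (simp_all add: f)
    also have "\<dots> = (\<Sum>i<n. complex_of_real ((L2_norm M (E (B i) f))\<^sup>2))"
    proof (intro sum.cong refl)
      fix i assume "i \<in> {..<n}"
      then have "C \<inter> B i = B i"
        using that(2) by auto
      then show "L2_inner M (E (B i) f) (E C f) = complex_of_real ((L2_norm M (E (B i) f))\<^sup>2)"
        using inner_E_E[of "B i" C f f] inner_E_self[of "B i" f] that f by simp
    qed
    finally show ?thesis
      by (simp add: s_def)
  qed
  have wv: "L2_inner M v (w n) = s n" for n
  proof -
    have "L2_inner M (w n) v = s n"
      unfolding v_def by (rule inner_w) auto
    then show ?thesis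
      by (subst L2_inner_commute) simp
  qed
  have "L2_inner M (w n) (w n) = (\<Sum>i<n. L2_inner M (E (B i) f) (w n))" for n
    by (subst w_def) (intro L2_inner_sum E_L2 w, simp_all add: f)
  moreover have "L2_inner M (E (B i) f) (w n) = complex_of_real ((L2_norm M (E (B i) f))\<^sup>2)"
    if "i < n" for i n
  proof -
    have "L2_inner M (w n) (E (B i) f) = (\<Sum>j<n. L2_inner M (E (B j) f) (E (B i) f))"
      unfolding w_def by (intro L2_inner_sum E_L2) (simp_all add: f)
    also have "\<dots> = (\<Sum>j<n. if j = i then complex_of_real ((L2_norm M (E (B i) f))\<^sup>2) else 0)"
    proof (intro sum.cong refl)
      fix j
      show "L2_inner M (E (B j) f) (E (B i) f) =
          (if j = i then complex_of_real ((L2_norm M (E (B i) f))\<^sup>2) else 0)"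
      proof (cases "j = i")
        case False
        then have "B i \<inter> B j = {}"
          using B(2) by (auto simp: disjoint_family_on_def)
        then show ?thesis
          using False inner_E_E[of "B j" "B i" f f] inner_E_self[of "{}" f] norm_E_empty f by simp
      qed (simp add: L2_inner_self)
    qed
    also have "\<dots> = complex_of_real ((L2_norm M (E (B i) f))\<^sup>2)"
      using that by simp
    finally show ?thesis
      by (subst L2_inner_commute) simp
  qed
  ultimately have "L2_inner M (w n) (w n) = s n" for n
    by (simp add: s_def)
  then have ww: "(L2_norm M (w n))\<^sup>2 = s n" for n
    by (metis L2_inner_self of_real_eq_iff)
  have "(L2_norm M v)\<^sup>2 - s n = (L2_norm M (\<lambda>x. v x - w n x))\<^sup>2" for n
    using L2_norm_diff_power2[OF v w, of n] by (simp add: wv ww)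
  note diff = this
  have *: "s n = (L2_norm M v)\<^sup>2 - (L2_norm M (\<lambda>x. v x - w n x))\<^sup>2" for n
    using diff[of n] by linarith
  have "(\<lambda>n. L2_norm M (\<lambda>x. v x - w n x)) \<longlonglongrightarrow> 0"
    unfolding v_def w_def by (rule E_UN[OF B f])
  then have "(\<lambda>n. (L2_norm M v)\<^sup>2 - (L2_norm M (\<lambda>x. v x - w n x))\<^sup>2) \<longlonglongrightarrow> (L2_norm M v)\<^sup>2 - 0\<^sup>2"
    by (intro tendsto_intros)
  then have "s \<longlonglongrightarrow> (L2_norm M v)\<^sup>2"
    unfolding *[symmetric] by simp
  then show ?thesis
    unfolding sums_def s_def v_def .
qed

lemma sets_\<mu> [measurable_cong, simp]: "sets (\<mu> f) = sets borel"
  unfolding scalar_spectral_measure_def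
  by (simp add: sets.sigma_sets_eq[of borel, simplified])

lemma space_\<mu> [simp]: "space (\<mu> f) = UNIV"
  by (simp add: scalar_spectral_measure_def space_measure_of_conv)

text \<open>\<open>measure_of\<close> returns the zero measure for a set function that is not
  countably additive, so the scalar spectral measure has its intended values only once
  \<open>norm_E_sums\<close> is available.\<close>

lemma emeasure_\<mu>:
  assumes "f \<in> L2 M" "B \<in> sets borel"
  shows "emeasure (\<mu> f) B = ennreal ((L2_norm M (E B f))\<^sup>2)"
  unfolding scalar_spectral_measure_def
proof (rule emeasure_measure_of_sigma)
  show "sigma_algebra UNIV (sets (borel :: real measure))"
    using sets.sigma_algebra_axioms[of "borel :: real measure"] by simp
  show "positive (sets borel) (\<lambda>B. ennreal ((L2_norm M (E B f))\<^sup>2))"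
    by (simp add: positive_def norm_E_empty assms)
  show "countably_additive (sets borel) (\<lambda>B. ennreal ((L2_norm M (E B f))\<^sup>2))"
  proof (rule countably_additiveI)
    fix B :: "nat \<Rightarrow> real set"
    assume "range B \<subseteq> sets borel" "disjoint_family B"
    then have "(\<lambda>i. (L2_norm M (E (B i) f))\<^sup>2) sums (L2_norm M (E (\<Union>i. B i) f))\<^sup>2"
      by (rule norm_E_sums) (rule assms)
    then show "(\<Sum>i. ennreal ((L2_norm M (E (B i) f))\<^sup>2)) =
        ennreal ((L2_norm M (E (\<Union>i. B i) f))\<^sup>2)"
      by (subst suminf_ennreal2) (auto simp: sums_iff)
  qed
qed fact

lemma finite_\<mu>: "f \<in> L2 M \<Longrightarrow> finite_measure (\<mu> f)"
  by (rule finite_measureI) (simp add: emeasure_\<mu>)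

lemma measure_\<mu>: "f \<in> L2 M \<Longrightarrow> B \<in> sets borel \<Longrightarrow> measure (\<mu> f) B = (L2_norm M (E B f))\<^sup>2"
  by (simp add: measure_def emeasure_\<mu>)

lemma emeasure_\<mu>_E:
  assumes "f \<in> L2 M" "B \<in> sets borel" "C \<in> sets borel"
  shows "emeasure (\<mu> (E B f)) C = emeasure (\<mu> f) (C \<inter> B)"
proof -
  have "L2_norm M (E (C \<inter> B) f) = L2_norm M (E C (E B f))"
    using assms by (intro L2_norm_cong E_Int E_L2) auto
  then show ?thesis
    using assms by (simp add: emeasure_\<mu> E_L2)
qed

end

section \<open>The spectral form\<close>

text \<open>The setwise estimate passes to integrals by induction on the measurable integrand. It
  serves to compare the spectral measure of a combination of two vectors, or of a projected vector,
  with those of the original vectors.\<close>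

lemma nn_integral_le_sum_measures:
  assumes sets: "sets M1 = sets N" "sets M2 = sets N"
    and le: "\<And>A. A \<in> sets N \<Longrightarrow> emeasure N A \<le> a * emeasure M1 A + b * emeasure M2 A"
    and "f \<in> borel_measurable N"
  shows "(\<integral>\<^sup>+x. f x \<partial>N) \<le> a * (\<integral>\<^sup>+x. f x \<partial>M1) + b * (\<integral>\<^sup>+x. f x \<partial>M2)"
  using assms(4)
proof induction
  case (cong f g)
  have "(\<integral>\<^sup>+x. f x \<partial>L) = (\<integral>\<^sup>+x. g x \<partial>L)" if "sets L = sets N" for L
    using sets_eq_imp_space_eq[OF that] cong by (intro nn_integral_cong) simp
  then show ?case
    using cong sets by simp
next
  case (set A)
  then show ?case
    using sets le by simp
next
  case (mult u c)
  have [measurable]: "u \<in> borel_measurable M1" "u \<in> borel_measurable M2"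
    using mult sets by (simp_all cong: measurable_cong_sets)
  have "c * (\<integral>\<^sup>+x. u x \<partial>N) \<le> c * (a * (\<integral>\<^sup>+x. u x \<partial>M1) + b * (\<integral>\<^sup>+x. u x \<partial>M2))"
    by (intro mult_left_mono mult.IH) simp
  then show ?case
    using mult by (simp add: nn_integral_cmult distrib_left mult_ac)
next
  case (add u v)
  have [measurable]: "u \<in> borel_measurable M1" "u \<in> borel_measurable M2"
      "v \<in> borel_measurable M1" "v \<in> borel_measurable M2"
    using add sets by (simp_all cong: measurable_cong_sets)
  show ?case
    using add add_mono[OF add.IH(1) add.IH(2)]
    by (simp add: nn_integral_add distrib_left ac_simps)
next
  case (seq U)
  have [measurable]: "\<And>i. U i \<in> borel_measurable M1" "\<And>i. U i \<in> borel_measurable M2"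
    using seq sets by (simp_all cong: measurable_cong_sets)
  have eq: "(\<integral>\<^sup>+x. (SUP i. U i) x \<partial>L) = (SUP i. \<integral>\<^sup>+x. U i x \<partial>L)" if "sets L = sets N" for L
    unfolding SUP_apply using seq that
    by (intro nn_integral_monotone_convergence_SUP) (simp_all cong: measurable_cong_sets)
  show ?case
    unfolding eq[OF refl] eq[OF sets(1)] eq[OF sets(2)]
  proof (rule SUP_least)
    fix i
    have "(\<integral>\<^sup>+x. U i x \<partial>N) \<le> a * (\<integral>\<^sup>+x. U i x \<partial>M1) + b * (\<integral>\<^sup>+x. U i x \<partial>M2)"
      by (rule seq.IH)
    also have "\<dots> \<le> a * (SUP i. \<integral>\<^sup>+x. U i x \<partial>M1) + b * (SUP i. \<integral>\<^sup>+x. U i x \<partial>M2)"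
      by (intro add_mono mult_left_mono SUP_upper) auto
    finally show "(\<integral>\<^sup>+x. U i x \<partial>N) \<le> \<dots>" .
  qed
qed

text \<open>Weighting either measure by the indicator of \<open>B\<close> produces the same measure,
  because only subsets of \<open>B\<close> are then charged.\<close>

lemma integral_indicator_cong_measure:
  fixes \<phi> :: "'b \<Rightarrow> real"
  assumes [measurable_cong, simp]: "sets N1 = sets N2"
    and [measurable]: "B \<in> sets N2" "\<phi> \<in> borel_measurable N2"
    and eq: "\<And>C. C \<in> sets N2 \<Longrightarrow> C \<subseteq> B \<Longrightarrow> emeasure N1 C = emeasure N2 C"
  shows "(LINT x|N1. indicator B x * \<phi> x) = (LINT x|N2. indicator B x * \<phi> x)"
proof -
  have "density N1 (\<lambda>x. ennreal (indicator B x)) = density N2 (\<lambda>x. ennreal (indicator B x))"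
  proof (rule measure_eqI)
    fix C assume "C \<in> sets (density N1 (\<lambda>x. ennreal (indicator B x)))"
    then have [measurable]: "C \<in> sets N2" by simp
    have "B \<inter> C \<in> sets N2" by measurable
    then show "emeasure (density N1 (\<lambda>x. ennreal (indicator B x))) C
      = emeasure (density N2 (\<lambda>x. ennreal (indicator B x))) C"
      using eq[of "B \<inter> C"] 
      by (simp add: emeasure_density ennreal_indicator indicator_inter_arith[symmetric]) 
  qed simp
  moreover have "(LINT x|N. indicator B x * \<phi> x) = (LINT x|density N (\<lambda>x. ennreal (indicator B x)). \<phi> x)"
    if [measurable_cong]: "sets N = sets N2" for N
    by (subst integral_density) simp_all
  ultimately show ?thesis
    by simp
qed

lemma integral_eq_scaled_measure:
  fixes \<phi> :: "'b \<Rightarrow> real"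
  assumes [simp]: "sets N1 = sets N2" and "0 \<le> r" and [measurable]: "\<phi> \<in> borel_measurable N2"
    and eq: "\<And>C. C \<in> sets N2 \<Longrightarrow> emeasure N1 C = ennreal r * emeasure N2 C"
  shows "(LINT x|N1. \<phi> x) = r * (LINT x|N2. \<phi> x)"
proof -
  have "N1 = density N2 (\<lambda>x. ennreal r)"
    by (rule measure_eqI) (simp_all add: emeasure_density_const eq)
  then show ?thesis
    using assms by (simp add: integral_density)
qed

text \<open>By this cancellation, a contribution that is the same for all four \<open>k\<close>
  drops out of the polarization sum.\<close>

lemma sum_imaginary_unit_powers: "(\<Sum>k<4. \<i> ^ k) = 0"
  by (simp add: eval_nat_numeral)

context pvm
begin

lemma norm_E_add_scaled_le:
  assumes "B \<in> sets borel" "f \<in> L2 M" "g \<in> L2 M"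
  shows "(L2_norm M (E B (\<lambda>x. f x + c * g x)))\<^sup>2
    \<le> 2 * (L2_norm M (E B f))\<^sup>2 + 2 * (cmod c)\<^sup>2 * (L2_norm M (E B g))\<^sup>2"
proof -
  let ?f = "E B f" and ?g = "E B g"
  have L2: "?f \<in> L2 M" "?g \<in> L2 M"
    using assms by (simp_all add: E_L2)
  have eq: "L2_norm M (E B (\<lambda>x. f x + c * g x)) = L2_norm M (\<lambda>x. ?f x + c * ?g x)"
    using assms L2 by (intro L2_norm_cong E_add_scaled E_L2 L2_add_scaled)
  \<comment> \<open>The parallelogram law; the term for the difference is then discarded.\<close>
  have "(L2_norm M (\<lambda>x. ?f x + c * ?g x))\<^sup>2 + (L2_norm M (\<lambda>x. ?f x + (- c) * ?g x))\<^sup>2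
      = 2 * (L2_norm M ?f)\<^sup>2 + 2 * (cmod c)\<^sup>2 * (L2_norm M ?g)\<^sup>2"
    unfolding L2_norm_add_scaled[OF L2] by simp
  moreover have "0 \<le> (L2_norm M (\<lambda>x. ?f x + (- c) * ?g x))\<^sup>2"
    by (rule zero_le_power2)
  ultimately show ?thesis
    unfolding eq by linarith
qed

lemma spectral_domain_L2: "f \<in> spectral_domain M E \<phi> \<Longrightarrow> f \<in> L2 M"
  by (simp add: spectral_domain_def)

text \<open>This puts all four vectors of the polarization sum into the domain, so that \<phi> is
  integrable against each of their measures.\<close>

lemma spectral_domain_add_scaled:
  assumes [measurable]: "\<phi> \<in> borel_measurable borel"
    and f: "f \<in> spectral_domain M E \<phi>" and g: "g \<in> spectral_domain M E \<phi>"
  shows "(\<lambda>x. f x + c * g x) \<in> spectral_domain M E \<phi>"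
proof -
  have L2: "f \<in> L2 M" "g \<in> L2 M" "(\<lambda>x. f x + c * g x) \<in> L2 M"
    using f g by (auto intro: L2_add_scaled spectral_domain_L2)
  have "(\<integral>\<^sup>+ t. ennreal ((\<phi> t)\<^sup>2) \<partial>\<mu> (\<lambda>x. f x + c * g x))
      \<le> ennreal 2 * (\<integral>\<^sup>+ t. ennreal ((\<phi> t)\<^sup>2) \<partial>\<mu> f)
        + ennreal (2 * (cmod c)\<^sup>2) * (\<integral>\<^sup>+ t. ennreal ((\<phi> t)\<^sup>2) \<partial>\<mu> g)"
  proof (rule nn_integral_le_sum_measures)
    fix A assume "A \<in> sets (\<mu> (\<lambda>x. f x + c * g x))"
    then have "A \<in> sets borel" by simp
    have "ennreal 2 * ennreal (a\<^sup>2) + ennreal (2 * (cmod c)\<^sup>2) * ennreal (b\<^sup>2)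
        = ennreal (2 * a\<^sup>2 + 2 * (cmod c)\<^sup>2 * b\<^sup>2)" for a b
      by (simp add: ennreal_mult)
    with \<open>A \<in> sets borel\<close> show "emeasure (\<mu> (\<lambda>x. f x + c * g x)) A
        \<le> ennreal 2 * emeasure (\<mu> f) A + ennreal (2 * (cmod c)\<^sup>2) * emeasure (\<mu> g) A"
      using norm_E_add_scaled_le[of A f g c] L2
      by (simp only: emeasure_\<mu> ennreal_leI)
  qed simp_all
  also have "\<dots> < \<infinity>"
    using f g by (auto simp: spectral_domain_def ennreal_mult_less_top)
  finally show ?thesis
    using L2 by (simp add: spectral_domain_def)
qed

lemma spectral_domain_E:
  assumes [measurable]: "\<phi> \<in> borel_measurable borel" and B [simp]: "B \<in> sets borel"
    and f: "f \<in> spectral_domain M E \<phi>"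
  shows "E B f \<in> spectral_domain M E \<phi>"
proof -
  have L2: "f \<in> L2 M"
    using f by (auto intro: spectral_domain_L2)
  have "(\<integral>\<^sup>+ t. ennreal ((\<phi> t)\<^sup>2) \<partial>\<mu> (E B f))
      \<le> 1 * (\<integral>\<^sup>+ t. ennreal ((\<phi> t)\<^sup>2) \<partial>\<mu> f) + 0 * (\<integral>\<^sup>+ t. ennreal ((\<phi> t)\<^sup>2) \<partial>\<mu> f)"
    by (rule nn_integral_le_sum_measures)
      (simp_all add: emeasure_\<mu>_E L2 emeasure_mono)
  also have "\<dots> < \<infinity>"
    using f by (auto simp: spectral_domain_def)
  finally show ?thesis
    using L2 by (simp add: spectral_domain_def E_L2)
qed

text \<open>On a finite measure square integrability suffices, since |\<phi>| is at most 1 +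
  \<phi>^2.\<close>

lemma spectral_domain_integrable:
  assumes [measurable]: "\<phi> \<in> borel_measurable borel" and f: "f \<in> spectral_domain M E \<phi>"
  shows "integrable (\<mu> f) \<phi>"
proof (rule Bochner_Integration.integrable_bound)
  interpret finite_measure "\<mu> f"
    using f by (intro finite_\<mu> spectral_domain_L2)
  have "integrable (\<mu> f) (\<lambda>t. (\<phi> t)\<^sup>2)"
    using f by (intro integrableI_nonneg) (auto simp: spectral_domain_def)
  then show "integrable (\<mu> f) (\<lambda>t. 1 + (\<phi> t)\<^sup>2)"
    by simp
  have "\<bar>a\<bar> \<le> 1 + a\<^sup>2" for a :: real
    using sum_squares_bound[of "\<bar>a\<bar>" 1] by auto
  then show "AE t in \<mu> f. norm (\<phi> t) \<le> norm (1 + (\<phi> t)\<^sup>2)"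
    by (auto simp: add_nonneg_nonneg)
qed simp

section \<open>Cutting the spectral form by spectral projections\<close>

lemma integral_split:
  fixes \<phi> :: "real \<Rightarrow> real"
  assumes [simp]: "B \<in> sets borel" and "integrable (\<mu> f) \<phi>"
  shows "(LINT t|\<mu> f. \<phi> t) = (LINT t|\<mu> f. indicator B t * \<phi> t) + (LINT t|\<mu> f. indicator (- B) t * \<phi> t)"
proof -
  have i: "integrable (\<mu> f) (\<lambda>t. indicator C t * \<phi> t)" if "C \<in> sets borel" for C
    using integrable_mult_indicator[of C "\<mu> f" \<phi>] that assms by simp
  have "(LINT t|\<mu> f. indicator B t * \<phi> t + indicator (- B) t * \<phi> t) = (LINT t|\<mu> f. \<phi> t)"
    by (intro Bochner_Integration.integral_cong) (auto split: split_indicator)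
  then show ?thesis
    using i[of B] i[of "- B"] by (simp add: borel_comp)
qed

text \<open>On subsets of \<open>B\<close> the inner projection \<open>E B\<close> is absorbed by
  \<open>E C\<close>, and on sets disjoint from \<open>B\<close> it is annihilated. The spectral
  measure of \<open>u + c * E B h\<close> is therefore that of \<open>u + c * h\<close> inside
  \<open>B\<close> and that of \<open>u\<close> outside.\<close>

lemma
  assumes u: "u \<in> L2 M" and h: "h \<in> L2 M" and [simp]: "B \<in> sets borel" "C \<in> sets borel"
  shows norm_E_add_E_subset: "C \<subseteq> B \<Longrightarrow>
      L2_norm M (E C (\<lambda>x. u x + c * E B h x)) = L2_norm M (E C (\<lambda>x. u x + c * h x))"
    and norm_E_add_E_disjoint: "C \<inter> B = {} \<Longrightarrow>
      L2_norm M (E C (\<lambda>x. u x + c * E B h x)) = L2_norm M (E C u)"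
proof -
  have L2: "(\<lambda>x. u x + c * E B h x) \<in> L2 M" "(\<lambda>x. u x + c * h x) \<in> L2 M" "E C h \<in> L2 M"
     "E C u \<in> L2 M" "E B h \<in> L2 M"
    by (simp_all add: L2_add_scaled E_L2 u h)
  have 1: "eq_ae M (E C (\<lambda>x. u x + c * E B h x)) (\<lambda>x. E C u x + c * E C (E B h) x)"
    and 2: "eq_ae M (E C (\<lambda>x. u x + c * h x)) (\<lambda>x. E C u x + c * E C h x)"
    and 3: "eq_ae M (E (C \<inter> B) h) (E C (E B h))"
    by (simp_all add: E_add_scaled E_Int u h L2)
  {
    assume "C \<subseteq> B"
    then have "C \<inter> B = C" by auto
    with 1 2 3 show "L2_norm M (E C (\<lambda>x. u x + c * E B h x)) = L2_norm M (E C (\<lambda>x. u x + c * h x))"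
      by (intro L2_norm_cong) (auto intro!: E_L2 L2 simp: eq_ae_def)
  next
    assume "C \<inter> B = {}"
    with 1 3 E_empty[OF h] show "L2_norm M (E C (\<lambda>x. u x + c * E B h x)) = L2_norm M (E C u)"
      by (intro L2_norm_cong) (auto intro!: E_L2 L2 simp: eq_ae_def)
  }
qed

lemma norm_E_scaled:
  assumes [simp]: "C \<in> sets borel" and h: "h \<in> L2 M"
  shows "(L2_norm M (E C (\<lambda>x. c * h x)))\<^sup>2 = (cmod c)\<^sup>2 * (L2_norm M (E C h))\<^sup>2"
proof -
  have L2: "E C h \<in> L2 M" "(\<lambda>x. c * h x) \<in> L2 M" "(\<lambda>x. c * E C h x) \<in> L2 M"
    using L2_lincomb[OF h L2_zero, of c 0] L2_lincomb[OF E_L2[of C h] L2_zero, of c 0] 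
    by (simp_all add: E_L2 h)
  have "L2_norm M (E C (\<lambda>x. c * h x)) = L2_norm M (\<lambda>x. c * E C h x)"
    using E_lincomb[of C h h c 0] h by (intro L2_norm_cong E_L2 L2) simp_all
  moreover have "(L2_norm M (\<lambda>x. c * E C h x))\<^sup>2 = (cmod c)\<^sup>2 * (L2_norm M (E C h))\<^sup>2"
    using L2_norm_add_scaled[OF L2_zero L2(1), of c] by (simp add: L2_inner_def L2_norm_def)
  ultimately show ?thesis
    by simp
qed

text \<open>The four vectors are multiples of \<open>f\<close> by 1 + i^k, with measures scaled by
  4, 2, 0, 2. The factors i^k leave 4, since the two imaginary terms cancel.\<close>

lemma spectral_form_self:
  assumes [measurable]: "\<phi> \<in> borel_measurable borel" and f: "f \<in> L2 M"
  shows "spectral_form M E \<phi> f f = complex_of_real (LINT t|\<mu> f. \<phi> t)"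
proof -
  have "(LINT t|\<mu> (\<lambda>x. f x + c * f x). \<phi> t) = (cmod (1 + c))\<^sup>2 * (LINT t|\<mu> f. \<phi> t)" for c
  proof (rule integral_eq_scaled_measure)
    fix C assume "C \<in> sets (\<mu> f)"
    then show "emeasure (\<mu> (\<lambda>x. f x + c * f x)) C = ennreal ((cmod (1 + c))\<^sup>2) * emeasure (\<mu> f) C"
      using norm_E_scaled[of C f "1 + c"] f L2_add_scaled[OF f f, of c]
      by (simp add: emeasure_\<mu> ennreal_mult'[symmetric] distrib_right)
  qed simp_all
  then show ?thesis
    unfolding spectral_form_def by (simp add: eval_nat_numeral cmod_power2[unfolded power2_eq_square])
qed

text \<open>Each polarization measure is split at \<open>B\<close>. Its part outside
  \<open>B\<close> is that of \<open>u\<close> for every \<open>k\<close> and cancels in the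
  sum.\<close>

lemma spectral_form_E_right:
  assumes [measurable]: "\<phi> \<in> borel_measurable borel" and B [simp, measurable]: "B \<in> sets borel"
    and u: "u \<in> spectral_domain M E \<phi>" and h: "h \<in> spectral_domain M E \<phi>"
  shows "spectral_form M E \<phi> u (E B h) = spectral_form M E (\<lambda>t. indicator B t * \<phi> t) u h"
proof -
  have L2: "u \<in> L2 M" "h \<in> L2 M" "E B h \<in> L2 M"
    "\<And>c. (\<lambda>x. u x + c * E B h x) \<in> L2 M"  "\<And>c. (\<lambda>x. u x + c * h x) \<in> L2 M"
    using u h by (simp_all add: spectral_domain_L2 L2_add_scaled E_L2)
  have "(LINT t|\<mu> (\<lambda>x. u x + c * E B h x). \<phi> t) =
      (LINT t|\<mu> (\<lambda>x. u x + c * h x). indicator B t * \<phi> t) + (LINT t|\<mu> u. indicator (- B) t * \<phi> t)" for c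
  proof -
    have 1: "(LINT t|\<mu> (\<lambda>x. u x + c * E B h x). indicator B t * \<phi> t) =
        (LINT t|\<mu> (\<lambda>x. u x + c * h x). indicator B t * \<phi> t)"
      by (rule integral_indicator_cong_measure) (simp_all add: emeasure_\<mu> L2 norm_E_add_E_subset)
    have "L2_norm M (E C (\<lambda>x. u x + c * E B h x)) = L2_norm M (E C u)"
      if "C \<in> sets borel" "C \<subseteq> - B" for C
      using norm_E_add_E_disjoint[OF L2(1,2) B that(1)] that(2) by blast
    then have 2: "(LINT t|\<mu> (\<lambda>x. u x + c * E B h x). indicator (- B) t * \<phi> t) =
        (LINT t|\<mu> u. indicator (- B) t * \<phi> t)"
      by (intro integral_indicator_cong_measure) (simp_all add: emeasure_\<mu> L2)
    have "integrable (\<mu> (\<lambda>x. u x + c * E B h x)) \<phi>"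
      by (intro spectral_domain_integrable spectral_domain_add_scaled spectral_domain_E u h) simp_all
    from integral_split[OF B this] show ?thesis
      by (simp only: 1 2)
  qed
  then have "spectral_form M E \<phi> u (E B h) = spectral_form M E (\<lambda>t. indicator B t * \<phi> t) u h +
      (\<Sum>k<4. \<i> ^ k) * complex_of_real (LINT t|\<mu> u. indicator (- B) t * \<phi> t) / 4"
    by (simp add: spectral_form_def distrib_left sum.distrib add_divide_distrib sum_distrib_right)
  then show ?thesis
    by (simp add: sum_imaginary_unit_powers)
qed

text \<open>Here the part outside \<open>B\<close> is the measure of \<open>c * h\<close>. As
  \<open>c\<close> is a power of the imaginary unit it has modulus 1, so this measure is that of
  \<open>h\<close> and again cancels.\<close>

lemma spectral_form_E_left:
  assumes [measurable]: "\<phi> \<in> borel_measurable borel" and B [simp, measurable]: "B \<in> sets borel"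
    and u: "u \<in> spectral_domain M E \<phi>" and h: "h \<in> spectral_domain M E \<phi>"
  shows "spectral_form M E \<phi> (E B u) h = spectral_form M E (\<lambda>t. indicator B t * \<phi> t) u h"
proof -
  have L2: "u \<in> L2 M" "h \<in> L2 M" "E B u \<in> L2 M"
    "\<And>c. (\<lambda>x. E B u x + c * h x) \<in> L2 M"  "\<And>c. (\<lambda>x. u x + c * h x) \<in> L2 M"
    using u h by (simp_all add: spectral_domain_L2 L2_add_scaled E_L2)
  have ch: "(\<lambda>x. c * h x) \<in> L2 M" for c
    using L2_lincomb[OF L2(2,2), of c 0] by simp
  have "(LINT t|\<mu> (\<lambda>x. E B u x + c * h x). \<phi> t) =
      (LINT t|\<mu> (\<lambda>x. u x + c * h x). indicator B t * \<phi> t) + (LINT t|\<mu> h. indicator (- B) t * \<phi> t)"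
    if c: "cmod c = 1" for c
  proof -
    \<comment> \<open>The roles are exchanged: \<open>c * h\<close> is the fixed vector and
      \<open>u\<close> is the one being cut, with coefficient 1.\<close>
    have 1: "(LINT t|\<mu> (\<lambda>x. E B u x + c * h x). indicator B t * \<phi> t) =
        (LINT t|\<mu> (\<lambda>x. u x + c * h x). indicator B t * \<phi> t)"
      using norm_E_add_E_subset[OF ch L2(1) B, of _ c 1]
      by (intro integral_indicator_cong_measure) (simp_all add: emeasure_\<mu> L2 add.commute)
    have "(L2_norm M (E C (\<lambda>x. E B u x + c * h x)))\<^sup>2 = (L2_norm M (E C h))\<^sup>2"
      if "C \<in> sets borel" "C \<subseteq> - B" for C
    proof -
      have "C \<inter> B = {}" using that by auto
      then show ?thesis
        using norm_E_add_E_disjoint[OF ch L2(1) B that(1), of c 1] norm_E_scaled[OF that(1) L2(2), of c] c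
        by (simp add: add.commute)
    qed
    then have 2: "(LINT t|\<mu> (\<lambda>x. E B u x + c * h x). indicator (- B) t * \<phi> t) =
        (LINT t|\<mu> h. indicator (- B) t * \<phi> t)"
      by (intro integral_indicator_cong_measure) (auto simp: emeasure_\<mu> L2)
    have "integrable (\<mu> (\<lambda>x. E B u x + c * h x)) \<phi>"
      by (intro spectral_domain_integrable spectral_domain_add_scaled spectral_domain_E u h) simp_all
    from integral_split[OF B this] show ?thesis
      by (simp only: 1 2)
  qed
  then have "spectral_form M E \<phi> (E B u) h = spectral_form M E (\<lambda>t. indicator B t * \<phi> t) u h +
      (\<Sum>k<4. \<i> ^ k) * complex_of_real (LINT t|\<mu> h. indicator (- B) t * \<phi> t) / 4"
    by (simp add: spectral_form_def norm_power distrib_left sum.distrib add_divide_distrib sum_distrib_right)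
  then show ?thesis
    by (simp add: sum_imaginary_unit_powers)
qed


section \<open>Spectrum and energy\<close>

text \<open>
  A non-zero vector in the range of \<open>E {..<0}\<close> need not lie in the domain of \<open>A\<close>; but for
  \<open>(u, k) \<in> A\<close> the pair \<open>(E {..<0} u, E {..<0} k)\<close> is again in \<open>A\<close>, and density of the domain
  allows its first component to be chosen non-zero, which contradicts positivity.
\<close>

lemma negative_spectrum_null:
  assumes dense: "densely_defined M A" and pos: "positive_operator M A"
    and A: "A = spectral_integral M E (\<lambda>t. t)" and f: "f \<in> L2 M"
  shows "emeasure (\<mu> f) {..<0} = 0"
proof (rule ccontr)
  let ?B = "{..<0 :: real}"
  assume "emeasure (\<mu> f) ?B \<noteq> 0"
  then have ne: "L2_norm M (E ?B f) \<noteq> 0"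
    by (simp add: emeasure_\<mu> f)
  define f1 where "f1 = E ?B f"
  have f1: "f1 \<in> L2 M"
    by (simp add: f1_def E_L2 f)
  have "L2_norm M f1 > 0"
    using ne L2_norm_nonneg[of M f1] by (simp add: f1_def)
  with dense f1 obtain u where "u \<in> Domain A" and u_near: "L2_norm M (\<lambda>x. f1 x - u x) < L2_norm M f1"
    unfolding densely_defined_def by blast
  then obtain k where "(u, k) \<in> A"
    by blast
  then have u: "u \<in> spectral_domain M E (\<lambda>t. t)" and k: "k \<in> L2 M"
    and uk: "\<And>h. h \<in> spectral_domain M E (\<lambda>t. t) \<Longrightarrow> L2_inner M k h = spectral_form M E (\<lambda>t. t) u h"
    by (auto simp: A spectral_integral_def)
  have uL2: "u \<in> L2 M"
    using u by (rule spectral_domain_L2)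
  define v where "v = E ?B u"
  have v: "v \<in> spectral_domain M E (\<lambda>t. t)" and vL2: "v \<in> L2 M"
    using u uL2 by (simp_all add: v_def spectral_domain_E E_L2)
  have "(v, E ?B k) \<in> A"
    unfolding A spectral_integral_def
  proof (intro CollectI case_prodI conjI ballI)
    fix h assume h: "h \<in> spectral_domain M E (\<lambda>t. t)"
    have "L2_inner M (E ?B k) h = L2_inner M k (E ?B h)"
      using h k by (simp add: E_symm spectral_domain_L2)
    also have "\<dots> = spectral_form M E (\<lambda>t. t) u (E ?B h)"
      using h by (intro uk spectral_domain_E) simp_all
    also have "\<dots> = spectral_form M E (\<lambda>t. t) v h"
      unfolding v_def using u h by (simp add: spectral_form_E_left spectral_form_E_right)
    finally show "L2_inner M (E ?B k) h = spectral_form M E (\<lambda>t. t) v h" .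
  qed (simp_all add: v E_L2 k)
  then have "0 \<le> Re (L2_inner M (E ?B k) v)" "L2_inner M (E ?B k) v = spectral_form M E (\<lambda>t. t) v v"
    using pos v unfolding positive_operator_def A spectral_integral_def by blast+
  then have ge: "0 \<le> (LINT t|\<mu> v. t)"
    by (simp add: spectral_form_self vL2)
  \<comment> \<open>The measure of \<open>v\<close> lives on the negative half-line, where the
    integral of t can be nonnegative only if the measure vanishes.\<close>
  have "emeasure (\<mu> v) {0..} = emeasure (\<mu> u) ({0..} \<inter> ?B)"
    unfolding v_def by (rule emeasure_\<mu>_E) (simp_all add: uL2)
  also have "{0..} \<inter> ?B = {}"
    by auto
  finally have null: "{0..} \<in> null_sets (\<mu> v)"
    by (simp add: null_sets_def)
  have neg: "AE t in \<mu> v. t < 0"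
    by (rule AE_I'[OF null]) auto
  have int: "integrable (\<mu> v) (\<lambda>t. t)"
    using v by (intro spectral_domain_integrable) simp_all
  have "0 \<le> (LINT t|\<mu> v. - t)"
    using neg by (intro integral_nonneg_AE) (auto elim: eventually_mono)
  with ge have "(LINT t|\<mu> v. - t) = 0"
    by simp
  moreover have "(LINT t|\<mu> v. - t) = 0 \<longleftrightarrow> (AE t in \<mu> v. - t = 0)"
  proof (rule integral_nonneg_eq_0_iff_AE)
    show "integrable (\<mu> v) (\<lambda>t. - t)"
      using int by simp
    show "AE t in \<mu> v. 0 \<le> - t"
      using neg by eventually_elim simp
  qed
  ultimately have "AE t in \<mu> v. - t = 0"
    by (simp only:)
  with neg have "AE t in \<mu> v. False"
    by eventually_elim simp
  then have "UNIV \<in> null_sets (\<mu> v)"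
    by (subst AE_iff_null_sets) simp_all
  then have "L2_norm M v = 0"
    by (simp add: null_sets_def emeasure_\<mu> vL2 norm_E_UNIV)
  then have "eq_ae M v (\<lambda>x. 0)"
    by (simp add: L2_norm_eq_0_iff vL2)
  moreover have "eq_ae M f1 (E ?B f1)"
    using E_Int[of ?B ?B f] f by (simp add: f1_def)
  moreover have "eq_ae M (E ?B (\<lambda>x. f1 x - u x)) (\<lambda>x. E ?B f1 x - v x)"
    using E_add_scaled[of ?B f1 u "-1"] f1 uL2 by (simp add: v_def)
  \<comment> \<open>Since \<open>v\<close> vanishes, projecting \<open>f1 - u\<close> returns
    \<open>f1\<close>. A projection does not increase norms, which contradicts the choice of
    \<open>u\<close> closer to \<open>f1\<close> than the norm of \<open>f1\<close>.\<close>
  ultimately have "eq_ae M (E ?B (\<lambda>x. f1 x - u x)) f1"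
    by (auto simp: eq_ae_def)
  then have "L2_norm M (E ?B (\<lambda>x. f1 x - u x)) = L2_norm M f1"
    by (intro L2_norm_cong E_L2 L2_diff) (simp_all add: f1 uL2)
  moreover have "L2_norm M (E ?B (\<lambda>x. f1 x - u x)) \<le> L2_norm M (\<lambda>x. f1 x - u x)"
    by (intro norm_E_le L2_diff) (simp_all add: f1 uL2)
  ultimately show False
    using u_near by simp
qed

text \<open>The vector \<open>E {0} f\<close> has its spectral measure concentrated at 0, so it lies
  in the kernel of \<open>A\<close>. Orthogonality of \<open>f\<close> to the kernel then forces its
  norm to be 0.\<close>

lemma zero_spectrum_null:
  assumes A: "A = spectral_integral M E (\<lambda>t. t)" and f: "f \<in> orth_kernel M A"
  shows "emeasure (\<mu> f) {0} = 0"
proof -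
  have fL2: "f \<in> L2 M"
    using f by (simp add: orth_kernel_def)
  define w where "w = E {0} f"
  have wL2: "w \<in> L2 M"
    by (simp add: w_def E_L2 fL2)
  have "emeasure (\<mu> w) (- {0}) = emeasure (\<mu> f) (- {0} \<inter> {0})"
    unfolding w_def by (rule emeasure_\<mu>_E) (simp_all add: fL2)
  then have null: "- {0} \<in> null_sets (\<mu> w)"
    by (simp add: null_sets_def)
  have "AE t in \<mu> w. t = 0"
    by (rule AE_I'[OF null]) auto
  then have "(\<integral>\<^sup>+ t. ennreal (t\<^sup>2) \<partial>\<mu> w) = (\<integral>\<^sup>+ t. 0 \<partial>\<mu> w)"
    by (intro nn_integral_cong_AE) (auto elim: eventually_mono)
  then have w: "w \<in> spectral_domain M E (\<lambda>t. t)"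
    by (simp add: spectral_domain_def wL2)
  \<comment> \<open>Projecting \<open>w\<close> once more makes \<open>spectral_form_E_left\<close>
    applicable: the weight t is cut down to the point 0, where it vanishes.\<close>
  have "(E {0} w, \<lambda>x. 0) \<in> A"
    unfolding A spectral_integral_def
  proof (intro CollectI case_prodI conjI ballI)
    fix h assume h: "h \<in> spectral_domain M E (\<lambda>t. t)"
    have "spectral_form M E (\<lambda>t. t) (E {0} w) h = spectral_form M E (\<lambda>t. indicator {0} t * t) w h"
      using w h by (simp add: spectral_form_E_left)
    also have "(\<lambda>t. indicator {0} t * t :: real) = (\<lambda>t. 0)"
      by (auto split: split_indicator)
    finally show "L2_inner M (\<lambda>x. 0) h = spectral_form M E (\<lambda>t. t) (E {0} w) h"
      by (simp add: L2_inner_def spectral_form_def)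
  qed (simp_all add: w spectral_domain_E L2_zero)
  then have "L2_inner M f (E {0} w) = 0"
    using f by (simp add: orth_kernel_def)
  then have "L2_inner M w w = 0"
    using E_symm[of "{0}" f w] fL2 wL2 by (simp add: w_def)
  then show ?thesis
    by (simp add: L2_inner_self emeasure_\<mu> fL2 w_def)
qed

text \<open>
  The local form of \<open>d\<mu>\<^sub>g = t d\<mu>\<^sub>f\<close> for \<open>g = A\<^sup>1\<^sup>/\<^sup>2 f\<close>; one inequality suffices, and needs
  only the weak definition of \<open>g\<close>.
\<close>

lemma norm_E_sqrt_ge:
  assumes fg: "(f, g) \<in> spectral_integral M E sqrt"
    and B [simp, measurable]: "B \<in> sets borel" and sub: "B \<subseteq> {r..}" and r: "0 \<le> r"
  shows "r * (L2_norm M (E B f))\<^sup>2 \<le> (L2_norm M (E B g))\<^sup>2"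
proof (cases "L2_norm M (E B f) = 0")
  case False
  have f: "f \<in> spectral_domain M E sqrt" and gL2: "g \<in> L2 M"
    and form: "\<And>h. h \<in> spectral_domain M E sqrt \<Longrightarrow> L2_inner M g h = spectral_form M E sqrt f h"
    using fg by (auto simp: spectral_integral_def)
  have fL2: "f \<in> L2 M"
    using f by (rule spectral_domain_L2)
  interpret finite_measure "\<mu> f"
    by (rule finite_\<mu>) fact
  have pos: "L2_norm M (E B f) > 0"
    using False L2_norm_nonneg[of M "E B f"] by simp
  have int: "integrable (\<mu> f) (\<lambda>t. indicator B t * sqrt t)"
    using integrable_mult_indicator[OF _ spectral_domain_integrable[OF _ f], of B] by simp
  \<comment> \<open>Testing \<open>g\<close> against \<open>E B f\<close> gives the integral of the
    square root over \<open>B\<close>. Cauchy--Schwarz bounds it by the norms of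
    \<open>E B g\<close> and \<open>E B f\<close>, and one factor is divided out.\<close>
  have "sqrt r * (L2_norm M (E B f))\<^sup>2 = (LINT t|\<mu> f. indicator B t * sqrt r)"
    by (simp add: measure_\<mu> fL2)
  also have "\<dots> \<le> (LINT t|\<mu> f. indicator B t * sqrt t)"
    using sub by (intro integral_mono int) (auto simp: less_top[symmetric] split: split_indicator)
  also have "complex_of_real \<dots> = spectral_form M E sqrt f (E B f)"
    using f by (simp add: spectral_form_E_right spectral_form_self fL2)
  then have "(LINT t|\<mu> f. indicator B t * sqrt t) = Re (spectral_form M E sqrt f (E B f))"
    by (metis Re_complex_of_real)
  also have "spectral_form M E sqrt f (E B f) = L2_inner M g (E B f)"
    using f by (intro form[symmetric] spectral_domain_E) simp_all
  also have "L2_inner M g (E B f) = L2_inner M (E B g) (E B f)"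
    using inner_E_E[of B B g f] E_symm[of B g f] fL2 gL2 by simp
  also have "Re \<dots> \<le> cmod \<dots>"
    by (rule complex_Re_le_cmod)
  also have "\<dots> \<le> L2_norm M (E B g) * L2_norm M (E B f)"
    by (intro L2_Cauchy_Schwarz E_L2) (simp_all add: fL2 gL2)
  finally have "sqrt r * L2_norm M (E B f) \<le> L2_norm M (E B g)"
    using pos by (simp add: power2_eq_square)
  then have "(sqrt r * L2_norm M (E B f))\<^sup>2 \<le> (L2_norm M (E B g))\<^sup>2"
    using pos r by (intro power_mono) auto
  then show ?thesis
    using r by (simp add: power_mult_distrib)
qed simp

text \<open>On a level set of a simple function below the identity, \<open>norm_E_sqrt_ge\<close>
  trades the value for a change of measure from \<open>f\<close> to \<open>g\<close>. The level sets
  are disjoint, so their masses sum to at most the squared norm of \<open>g\<close>.\<close>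

lemma nn_integral_le_norm_sqrt:
  assumes fg: "(f, g) \<in> spectral_integral M E sqrt"
  shows "(\<integral>\<^sup>+ t. ennreal t \<partial>\<mu> f) \<le> ennreal ((L2_norm M g)\<^sup>2)"
  unfolding nn_integral_def
proof (rule SUP_least)
  have fL2: "f \<in> L2 M" and gL2: "g \<in> L2 M"
    using fg by (auto simp: spectral_integral_def spectral_domain_L2)
  fix s assume "s \<in> {s. simple_function (\<mu> f) s \<and> s \<le> ennreal}"
  then have s: "simple_function (\<mu> f) s" and le: "\<And>t. s t \<le> ennreal t"
    by (auto simp: le_fun_def)
  have [simp]: "s -` {y} \<in> sets borel" for y
    using simple_functionD(2)[OF s, of "{y}"] by simp
  have fin: "finite (range s)"
    using simple_functionD(1)[OF s] by simp
  have "integral\<^sup>S (\<mu> f) s = (\<Sum>y\<in>range s. y * emeasure (\<mu> f) (s -` {y}))"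
    by (simp add: simple_integral_def)
  also have "\<dots> \<le> (\<Sum>y\<in>range s. emeasure (\<mu> g) (s -` {y}))"
  proof (rule sum_mono)
    fix y assume "y \<in> range s"
    then obtain t where "y = s t" by auto
    with le[of t] have "y < top"
      using ennreal_less_top le_less_trans by blast
    then obtain r where r: "y = ennreal r" "0 \<le> r"
      by (cases y) auto
    \<comment> \<open>The value 0 is treated apart: its level set may contain negative points,
      because \<open>ennreal\<close> truncates them to 0.\<close>
    show "y * emeasure (\<mu> f) (s -` {y}) \<le> emeasure (\<mu> g) (s -` {y})"
    proof (cases "r = 0")
      case False
      have "s -` {y} \<subseteq> {r..}"
        using le r False by (auto simp: vimage_def) (metis ennreal_le_iff2 not_less order_le_less)
      then show ?thesis
        using norm_E_sqrt_ge[OF fg, of "s -` {y}" r] r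
        by (simp add: emeasure_\<mu> fL2 gL2 ennreal_mult'[symmetric])
    qed (simp add: r)
  qed
  also have "\<dots> = emeasure (\<mu> g) (\<Union>y\<in>range s. s -` {y})"
    by (rule sum_emeasure) (auto simp: fin disjoint_family_on_def)
  also have "\<dots> \<le> emeasure (\<mu> g) UNIV"
    by (rule emeasure_mono) auto
  also have "\<dots> = ennreal ((L2_norm M g)\<^sup>2)"
    by (simp add: emeasure_\<mu> gL2 norm_E_UNIV)
  finally show "integral\<^sup>S (\<mu> f) s \<le> ennreal ((L2_norm M g)\<^sup>2)" .
qed

lemma nn_integral_le_energy: "(\<integral>\<^sup>+ t. ennreal t \<partial>\<mu> f) \<le> energy M E f"
  unfolding energy_def by (rule INF_greatest) (auto intro: nn_integral_le_norm_sqrt)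

end

section \<open>Ultracontractive bounds\<close>

text \<open>The test functions over which \<open>norm_L1_Linf\<close> takes its supremum.\<close>

definition L1_ball :: "'a measure \<Rightarrow> ('a \<Rightarrow> complex) set" where
  "L1_ball M = {g \<in> L2 M. integrable M g \<and> (LINT x|M. cmod (g x)) \<le> 1}"

text \<open>If |h| exceeded some D > C on a set \<open>S\<close> of positive measure, then
  \<open>sgn h\<close> restricted to \<open>S\<close> and divided by the measure of \<open>S\<close>
  would be a test function with pairing at least D. Chebyshev's inequality makes the measure of
  \<open>S\<close> finite.\<close>

lemma AE_norm_le_dual:
  assumes h: "h \<in> L2 M" and C: "0 \<le> C"
    and dual: "\<And>g. g \<in> L1_ball M \<Longrightarrow> cmod (L2_inner M h g) \<le> C"
  shows "AE x in M. cmod (h x) \<le> C"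
proof -
  have [measurable]: "h \<in> borel_measurable M"
    using h by (rule L2_measurable)
  have less: "AE x in M. cmod (h x) \<le> D" if "C < D" for D
  proof -
    define S where "S = {x \<in> space M. D < cmod (h x)}"
    have [measurable]: "S \<in> sets M"
      unfolding S_def by measurable
    have D: "0 < D"
      using C that by simp
    have "ennreal (D\<^sup>2) * emeasure M S = (\<integral>\<^sup>+x. ennreal (D\<^sup>2) * indicator S x \<partial>M)"
      by (simp add: nn_integral_cmult)
    also have "\<dots> \<le> (\<integral>\<^sup>+x. ennreal ((cmod (h x))\<^sup>2) \<partial>M)"
      using D by (intro nn_integral_mono)
        (auto simp: S_def intro!: ennreal_leI power_mono split: split_indicator)
    also have "\<dots> < \<infinity>"
      using L2_integrable_power2[OF h] by (simp add: nn_integral_eq_integral)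
    finally have fin: "emeasure M S < \<infinity>"
      using D by (auto simp: ennreal_mult_less_top)
    have "measure M S = 0"
    proof (rule ccontr)
      assume "measure M S \<noteq> 0"
      then have m: "measure M S > 0"
        using measure_nonneg[of M S] by linarith
      define g where "g = (\<lambda>x. complex_of_real (indicator S x / measure M S) * sgn (h x))"
      have [measurable]: "g \<in> borel_measurable M"
        unfolding g_def sgn_div_norm by measurable
      have g: "cmod (g x) = indicator S x / measure M S" for x
        using D m by (auto simp: g_def S_def norm_mult norm_divide norm_sgn split: split_indicator)
      have S: "integrable M (\<lambda>x. indicator S x :: real)"
        using fin by simp
      have "integrable M g"
        by (rule Bochner_Integration.integrable_bound[OF integrable_divide[OF S, of "measure M S"]])
          (simp_all add: g)
      moreover have "integrable M (\<lambda>x. (cmod (g x))\<^sup>2)"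
        unfolding g by (rule Bochner_Integration.integrable_cong[THEN iffD1, OF refl _
              integrable_divide[OF S, of "(measure M S)\<^sup>2"]])
           (auto simp: power_divide split: split_indicator)
      moreover have "(LINT x|M. cmod (g x)) = 1"
        using m fin by (simp add: g)
      ultimately have gD: "g \<in> L1_ball M"
        by (simp add: L1_ball_def L2_def)
      have eq: "h x * cnj (g x) = complex_of_real (indicator S x / measure M S * cmod (h x))" for x
      proof -
        have "h x * cnj (sgn (h x)) = complex_of_real (cmod (h x))"
          by (cases "h x = 0")
            (simp_all add: sgn_div_norm scaleR_conv_of_real complex_norm_square[symmetric]
              power2_eq_square mult.left_commute[of "h x"] del: of_real_mult, simp add: field_simps)
        then show ?thesis
          by (simp add: g_def mult.left_commute)
      qed
      have "integrable M (\<lambda>x. h x * cnj (g x))"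
        using gD h by (intro L2_integrable_mult) (auto simp: L1_ball_def)
      then have int: "integrable M (\<lambda>x. indicator S x / measure M S * cmod (h x))"
        unfolding eq using complex_of_real_integrable_eq by blast
      have "D = (LINT x|M. indicator S x / measure M S * D)"
        using m fin by simp
      also have "\<dots> \<le> (LINT x|M. indicator S x / measure M S * cmod (h x))"
        using S m by (intro integral_mono int integrable_mult_left integrable_divide)
          (auto simp: S_def divide_right_mono split: split_indicator)
      also have "\<dots> = cmod (complex_of_real \<dots>)"
      proof -
        have "0 \<le> (LINT x|M. indicator S x / measure M S * cmod (h x))"
          by (intro Bochner_Integration.integral_nonneg) simp
        then show ?thesis
          by (simp only: norm_of_real abs_of_nonneg)
      qed
      also have "complex_of_real (LINT x|M. indicator S x / measure M S * cmod (h x)) = L2_inner M h g"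
        unfolding L2_inner_def eq integral_complex_of_real ..
      also have "cmod \<dots> \<le> C"
        by (rule dual) fact
      finally show False
        using that by simp
    qed
    then have "S \<in> null_sets M"
      using fin emeasure_eq_ennreal_measure[of M S] by (intro null_setsI) auto
    then show ?thesis
      by (rule AE_I') (auto simp: S_def)
  qed
  \<comment> \<open>Countably many thresholds decreasing to \<open>C\<close> allow the exceptional
    null sets to be united.\<close>
  have "AE x in M. \<forall>n::nat. cmod (h x) \<le> C + 1 / real (Suc n)"
    by (subst AE_all_countable) (intro allI less, simp)
  then show ?thesis
  proof eventually_elim
    case (elim x)
    show ?case
    proof (rule field_le_epsilon)
      fix \<epsilon> :: real assume "0 < \<epsilon>"
      then obtain n where "1 / real (Suc n) < \<epsilon>"
        using nat_approx_posE by blast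
      with elim[rule_format, of n] show "cmod (h x) \<le> C + \<epsilon>"
        by linarith
    qed
  qed
qed

text \<open>
  This is \<open>\<parallel>A\<^sup>-\<^sup>1 \<Pi>\<^sub>l\<parallel>\<^bsub>1,\<infinity>\<^esub>\<close> computed through its quadratic form. Unlike
  \<open>stieltjes_G\<close> it is obviously monotone in \<open>l\<close>, and the upper bound by \<open>stieltjes_G\<close> is all
  that is needed to compare the right inverses.
\<close>

definition green_bound ::
    "'a measure \<Rightarrow> (real set \<Rightarrow> ('a \<Rightarrow> complex) \<Rightarrow> ('a \<Rightarrow> complex)) \<Rightarrow> real \<Rightarrow> ennreal" where
  "green_bound M E l =
     (SUP g\<in>L1_ball M. \<integral>\<^sup>+ t\<in>{0<..l}. ennreal (1 / t) \<partial>(scalar_spectral_measure M E g))"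

lemma green_bound_mono: "l \<le> l' \<Longrightarrow> green_bound M E l \<le> green_bound M E l'"
  unfolding green_bound_def
  by (intro SUP_subset_mono order_refl nn_set_integral_set_mono) auto

context pvm
begin

text \<open>The mass is the pairing of the projected \<open>g\<close> with \<open>g\<close>, and
  Hoelder's inequality applies with exponents infinity and 1.\<close>

lemma emeasure_\<mu>_le_spectral_F:
  assumes "g \<in> L1_ball M"
  shows "emeasure (\<mu> g) {0<..u} \<le> spectral_F M E u"
proof -
  let ?P = "E {0<..u} g" and ?c = "esssup M (\<lambda>x. ennreal (cmod (E {0<..u} g x)))"
  have g: "g \<in> L2 M" "integrable M g" "(LINT x|M. cmod (g x)) \<le> 1"
    using assms by (auto simp: L1_ball_def)
  have P: "?P \<in> L2 M"
    by (simp add: E_L2 g)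
  have [measurable]: "g \<in> borel_measurable M" "?P \<in> borel_measurable M"
    using g P by (auto intro: L2_measurable)
  have "emeasure (\<mu> g) {0<..u} = ennreal (cmod (L2_inner M ?P g))"
    by (simp add: emeasure_\<mu> g inner_E_self del: of_real_power)
  also have "\<dots> \<le> (\<integral>\<^sup>+x. ennreal (cmod (?P x * cnj (g x))) \<partial>M)"
    unfolding L2_inner_def by (intro integral_norm_bound_ennreal L2_integrable_mult P g)
  also have "\<dots> \<le> (\<integral>\<^sup>+x. ?c * ennreal (cmod (g x)) \<partial>M)"
    using esssup_AE[of "\<lambda>x. ennreal (cmod (?P x))" M]
    by (intro nn_integral_mono_AE) (auto elim!: eventually_mono simp: norm_mult ennreal_mult mult_right_mono)
  also have "\<dots> = ?c * ennreal (LINT x|M. cmod (g x))"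
    using g by (simp add: nn_integral_cmult nn_integral_eq_integral)
  also have "\<dots> \<le> ?c * 1"
    using g by (intro mult_left_mono) (simp_all add: ennreal_le_1)
  also have "\<dots> \<le> spectral_F M E u"
    using g unfolding spectral_F_def norm_L1_Linf_def by (simp, intro SUP_upper) auto
  finally show ?thesis .
qed

text \<open>For 0 < t \<le> l, 1/t is 1/l plus the integral of 1/u^2 from t to l. Tonelli's theorem
  then turns the inner integral over t into the mass of \<open>{0<..u}\<close>, which is at most
  F(u).\<close>

lemma green_bound_le_stieltjes_G:
  assumes l: "0 < l"
  shows "green_bound M E l \<le> stieltjes_G (spectral_F M E) l"
  unfolding green_bound_def
proof (rule SUP_least)
  fix g assume g: "g \<in> L1_ball M"
  then interpret finite_measure "\<mu> g"
    by (intro finite_\<mu>) (simp add: L1_ball_def)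
  interpret pair_sigma_finite "\<mu> g" lborel ..
  define k where "k = (\<lambda>(t::real, u::real). ennreal (1 / u\<^sup>2) * indicator {x. 0 < fst x \<and> fst x \<le> snd x \<and> snd x \<le> l} (t, u))"
  have k [measurable]: "k \<in> borel_measurable (\<mu> g \<Otimes>\<^sub>M lborel)"
    unfolding k_def by measurable
  have inv: "ennreal (1 / t) * indicator {0<..l} t =
      ennreal (1 / l) * indicator {0<..l} t + (\<integral>\<^sup>+u. k (t, u) \<partial>lborel)" for t
  proof (cases "t \<in> {0<..l}")
    case True
    have "(\<integral>\<^sup>+u. k (t, u) \<partial>lborel) = (\<integral>\<^sup>+u. ennreal (1 / u\<^sup>2) * indicator {t..l} u \<partial>lborel)"
      using True by (intro nn_integral_cong) (auto simp: k_def split: split_indicator)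
    also have "\<dots> = ennreal (- (1 / l) - (- (1 / t)))"
      using True
      by (intro nn_integral_FTC_Icc)
        (auto intro!: derivative_eq_intros simp: power2_eq_square)
    finally show ?thesis
      using True by (simp add: ennreal_plus[symmetric] frac_le del: ennreal_plus)
  next
    case False
    then have "k (t, u) = 0" for u
      by (auto simp: k_def)
    with False show ?thesis
      by simp
  qed
  have "(\<integral>\<^sup>+t\<in>{0<..l}. ennreal (1 / t) \<partial>\<mu> g) =
      ennreal (1 / l) * emeasure (\<mu> g) {0<..l} + (\<integral>\<^sup>+t. \<integral>\<^sup>+u. k (t, u) \<partial>lborel \<partial>\<mu> g)"
    unfolding inv by (subst nn_integral_add) (simp_all add: nn_integral_cmult)
  also have "(\<integral>\<^sup>+t. \<integral>\<^sup>+u. k (t, u) \<partial>lborel \<partial>\<mu> g) = (\<integral>\<^sup>+u. \<integral>\<^sup>+t. k (t, u) \<partial>\<mu> g \<partial>lborel)"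
    by (rule Fubini'[symmetric]) (simp add: k)
  also have "\<dots> \<le> (\<integral>\<^sup>+u\<in>{0<..l}. ennreal (1 / u\<^sup>2) * spectral_F M E u \<partial>lborel)"
  proof (rule nn_integral_mono)
    fix u
    have "(\<integral>\<^sup>+t. k (t, u) \<partial>\<mu> g) =
        (\<integral>\<^sup>+t. ennreal (1 / u\<^sup>2) * indicator {0<..l} u * indicator {0<..u} t \<partial>\<mu> g)"
      by (intro nn_integral_cong) (auto simp: k_def split: split_indicator)
    also have "\<dots> = ennreal (1 / u\<^sup>2) * indicator {0<..l} u * emeasure (\<mu> g) {0<..u}"
      by (simp add: nn_integral_cmult)
    also have "\<dots> \<le> ennreal (1 / u\<^sup>2) * indicator {0<..l} u * spectral_F M E u"
      by (intro mult_left_mono emeasure_\<mu>_le_spectral_F g) simp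
    finally show "(\<integral>\<^sup>+t. k (t, u) \<partial>\<mu> g) \<le> ennreal (1 / u\<^sup>2) * spectral_F M E u * indicator {0<..l} u"
      by (simp add: mult_ac)
  qed
  also have "ennreal (1 / l) * emeasure (\<mu> g) {0<..l} \<le> ennreal (1 / l) * spectral_F M E l"
    by (intro mult_left_mono emeasure_\<mu>_le_spectral_F g) simp
  finally show "(\<integral>\<^sup>+t\<in>{0<..l}. ennreal (1 / t) \<partial>\<mu> g) \<le> stieltjes_G (spectral_F M E) l"
    by (simp add: stieltjes_G_def add_mono)
qed

end

section \<open>Weighted Cauchy--Schwarz inequality in the spectral variable\<close>

lemma geometric_partition:
  fixes l q :: real
  assumes l: "0 < l" and q: "0 < q" "q < 1"
  shows "disjoint_family (\<lambda>j. {l * q ^ Suc j<..l * q ^ j})"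
    and "(\<Union>j. {l * q ^ Suc j<..l * q ^ j}) = {0<..l}"
proof -
  have le: "l * q ^ j \<le> l * q ^ i" if "i \<le> j" for i j
    using l q that by (intro mult_left_mono power_decreasing) auto
  show "disjoint_family (\<lambda>j. {l * q ^ Suc j<..l * q ^ j})"
    unfolding disjoint_family_on_def
  proof (intro ballI impI)
    fix i j :: nat assume "i \<noteq> j"
    then consider "Suc i \<le> j" | "Suc j \<le> i" by linarith
    then show "{l * q ^ Suc i<..l * q ^ i} \<inter> {l * q ^ Suc j<..l * q ^ j} = {}"
      using le[of "Suc i" j] le[of "Suc j" i] by cases auto
  qed
  show "(\<Union>j. {l * q ^ Suc j<..l * q ^ j}) = {0<..l}"
  proof (intro equalityI subsetI)
    fix t assume "t \<in> (\<Union>j. {l * q ^ Suc j<..l * q ^ j})"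
    then obtain j where j: "l * q ^ Suc j < t" "t \<le> l * q ^ j"
      by auto
    have "0 < l * q ^ Suc j"
      using l q by simp
    with j le[of 0 j] show "t \<in> {0<..l}"
      by simp
  next
    fix t assume t: "t \<in> {0<..l}"
    obtain n where "q ^ n < t / l"
      using real_arch_pow_inv[of "t / l" q] l q t by auto
    then have "l * q ^ n < t"
      using l by (simp add: field_simps)
    then have n: "l * q ^ Suc n < t"
      using le[of n "Suc n"] by linarith
    \<comment> \<open>Minimality gives the upper bound on \<open>t\<close> from the failure at the
      preceding index; at index 0 it is just \<open>t \<le> l\<close>.\<close>
    define j where "j = (LEAST n. l * q ^ Suc n < t)"
    have "l * q ^ Suc j < t"
      unfolding j_def by (rule LeastI) (rule n)
    moreover have "t \<le> l * q ^ j"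
    proof (cases j)
      case (Suc i)
      then show ?thesis
        using not_less_Least[of i "\<lambda>n. l * q ^ Suc n < t"] unfolding j_def[symmetric] by simp
    qed (use t in simp)
    ultimately show "t \<in> (\<Union>j. {l * q ^ Suc j<..l * q ^ j})"
      by auto
  qed
qed

lemma sum_emeasure_le_nn_integral:
  fixes B :: "nat \<Rightarrow> 'b set" and a :: "nat \<Rightarrow> ennreal"
  assumes disj: "disjoint_family B" and [measurable]: "\<And>j. B j \<in> sets N" "\<phi> \<in> borel_measurable N"
    and le: "\<And>j t. t \<in> B j \<Longrightarrow> a j \<le> \<phi> t"
  shows "(\<Sum>j<n. a j * emeasure N (B j)) \<le> (\<integral>\<^sup>+t\<in>(\<Union>j. B j). \<phi> t \<partial>N)"
proof -
  have "(\<Sum>j<n. a j * emeasure N (B j)) = (\<Sum>j<n. \<integral>\<^sup>+t. a j * indicator (B j) t \<partial>N)"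
    by (simp add: nn_integral_cmult)
  also have "\<dots> \<le> (\<Sum>j<n. \<integral>\<^sup>+t. \<phi> t * indicator (B j) t \<partial>N)"
    using le by (intro sum_mono nn_integral_mono) (simp split: split_indicator)
  also have "\<dots> = (\<integral>\<^sup>+t. (\<Sum>j<n. \<phi> t * indicator (B j) t) \<partial>N)"
    by (rule nn_integral_sum[symmetric]) measurable
  also have "\<dots> \<le> (\<integral>\<^sup>+t\<in>(\<Union>j. B j). \<phi> t \<partial>N)"
  proof (rule nn_integral_mono)
    fix t
    have "(\<Sum>j<n. \<phi> t * indicator (B j) t) = \<phi> t * indicator (\<Union>j<n. B j) t"
      using disj by (subst indicator_UN_disjoint)
        (auto simp: sum_distrib_left disjoint_family_on_def)
    then show "(\<Sum>j<n. \<phi> t * indicator (B j) t) \<le> \<phi> t * indicator (\<Union>j. B j) t"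
      by (auto split: split_indicator)
  qed
  finally show ?thesis .
qed

text \<open>Completing the square. In this additive form the weights can be summed piece by piece,
  and a free scale remains to be optimised.\<close>

lemma weighted_am_gm:
  fixes x y a :: real
  assumes "0 < a"
  shows "2 * (x * y) \<le> a * x\<^sup>2 + y\<^sup>2 / a"
proof -
  have "0 \<le> (a * x - y)\<^sup>2 / a"
    using assms by simp
  also have "\<dots> = a * x\<^sup>2 + y\<^sup>2 / a - 2 * (x * y)"
    using assms by (simp add: power2_eq_square field_simps)
  finally show ?thesis
    by simp
qed

context pvm
begin

text \<open>
  The weighted Cauchy--Schwarz inequality is applied on the pieces of a geometric partition of
  \<open>]0, l]\<close> of ratio \<open>q\<close>, on each of which the weight varies by at most the factor \<open>q\<close>; this is
  the source of the loss, which disappears as \<open>q\<close> tends to \<open>1\<close>.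
\<close>

lemma inner_E_le_partition:
  assumes f: "f \<in> L2 M" and g: "g \<in> L2 M" and l: "0 < l" and s: "0 < s" and q: "0 < q" "q < 1"
    and e: "0 \<le> e" "(\<integral>\<^sup>+t. ennreal t \<partial>\<mu> f) \<le> ennreal e"
    and k: "0 \<le> k" "(\<integral>\<^sup>+t\<in>{0<..l}. ennreal (1 / t) \<partial>\<mu> g) \<le> ennreal k"
  shows "2 * cmod (L2_inner M (E {0<..l} g) f) \<le> s * e + k / (q * s)"
proof -
  define B where "B j = {l * q ^ Suc j<..l * q ^ j}" for j
  have disj: "disjoint_family B" and UN: "(\<Union>j. B j) = {0<..l}"
    using geometric_partition[OF l q] by (simp_all add: B_def[abs_def])
  have [simp, measurable]: "B j \<in> sets borel" for j
    by (simp add: B_def)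
  let ?f = "\<lambda>j. L2_norm M (E (B j) f)" and ?g = "\<lambda>j. L2_norm M (E (B j) g)"
  have pos: "0 < l * q ^ j" for j
    using l q by simp
  have "ennreal (\<Sum>j<n. (l * q ^ Suc j) * (?f j)\<^sup>2) \<le> ennreal e" for n
  proof -
    have "ennreal (\<Sum>j<n. (l * q ^ Suc j) * (?f j)\<^sup>2)
        = (\<Sum>j<n. ennreal (l * q ^ Suc j) * emeasure (\<mu> f) (B j))"
      using pos by (subst sum_ennreal[symmetric])
        (auto simp: emeasure_\<mu> f ennreal_mult less_imp_le simp del: power_Suc)
    also have "\<dots> \<le> (\<integral>\<^sup>+t\<in>(\<Union>j. B j). ennreal t \<partial>\<mu> f)"
      by (intro sum_emeasure_le_nn_integral disj) (auto simp: B_def intro!: ennreal_leI)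
    also have "\<dots> \<le> (\<integral>\<^sup>+t. ennreal t \<partial>\<mu> f)"
      by (intro nn_integral_mono) (auto split: split_indicator)
    also note e(2)
    finally show ?thesis .
  qed
  then have sum_f: "(\<Sum>j<n. (l * q ^ Suc j) * (?f j)\<^sup>2) \<le> e" for n
    using e by simp
  have "ennreal (\<Sum>j<n. 1 / (l * q ^ j) * (?g j)\<^sup>2) \<le> ennreal k" for n
  proof -
    have "ennreal (\<Sum>j<n. 1 / (l * q ^ j) * (?g j)\<^sup>2)
        = (\<Sum>j<n. ennreal (1 / (l * q ^ j) * (?g j)\<^sup>2))"
      using l q by (intro sum_ennreal[symmetric]) simp
    also have "\<dots> = (\<Sum>j<n. ennreal (1 / (l * q ^ j)) * emeasure (\<mu> g) (B j))"
      using l q by (intro sum.cong refl, subst ennreal_mult) (simp_all add: emeasure_\<mu> g)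
    also have "\<dots> \<le> (\<integral>\<^sup>+t\<in>(\<Union>j. B j). ennreal (1 / t) \<partial>\<mu> g)"
    proof (intro sum_emeasure_le_nn_integral disj ennreal_leI)
      fix j t assume "t \<in> B j"
      moreover have "0 < l * q ^ Suc j"
        by (rule pos)
      ultimately show "1 / (l * q ^ j) \<le> 1 / t"
        by (intro frac_le) (auto simp: B_def)
    qed simp_all
    also note k(2)[folded UN]
    finally show ?thesis .
  qed
  then have sum_g: "(\<Sum>j<n. 1 / (l * q ^ j) * (?g j)\<^sup>2) \<le> k" for n
    using k by simp
  have sum_le: "2 * cmod (\<Sum>j<n. L2_inner M (E (B j) g) f) \<le> s * e + k / (q * s)" for n
  proof -
    have "2 * cmod (L2_inner M (E (B j) g) f) \<le>
        s * ((l * q ^ Suc j) * (?f j)\<^sup>2) + (1 / (l * q ^ j) * (?g j)\<^sup>2) / (q * s)" for j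
    proof -
      have "L2_inner M (E (B j) g) f = L2_inner M (E (B j) g) (E (B j) f)"
        using inner_E_E[of "B j" "B j" g f] f g by simp
      also have "cmod \<dots> \<le> ?g j * ?f j"
        by (intro L2_Cauchy_Schwarz E_L2 f g) simp_all
      finally have "2 * cmod (L2_inner M (E (B j) g) f) \<le> 2 * (?f j * ?g j)"
        by (simp add: mult.commute)
      \<comment> \<open>The energy sum uses the lower endpoint of the piece, while the bound on 1/t
        uses the upper one; the quotient of the endpoints is the \<open>q\<close> in the last
        denominator.\<close>
      also have "\<dots> \<le> s * (l * q ^ Suc j) * (?f j)\<^sup>2 + (?g j)\<^sup>2 / (s * (l * q ^ Suc j))"
        using s l q by (intro weighted_am_gm mult_pos_pos) simp_all
      also have "\<dots> = s * ((l * q ^ Suc j) * (?f j)\<^sup>2) + (1 / (l * q ^ j) * (?g j)\<^sup>2) / (q * s)"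
        by (simp add: mult_ac)
      finally show ?thesis .
    qed
    then have "(\<Sum>j<n. 2 * cmod (L2_inner M (E (B j) g) f)) \<le>
        (\<Sum>j<n. s * ((l * q ^ Suc j) * (?f j)\<^sup>2) + (1 / (l * q ^ j) * (?g j)\<^sup>2) / (q * s))"
      by (rule sum_mono)
    also have "\<dots> = s * (\<Sum>j<n. (l * q ^ Suc j) * (?f j)\<^sup>2) + (\<Sum>j<n. 1 / (l * q ^ j) * (?g j)\<^sup>2) / (q * s)"
      by (simp only: sum.distrib sum_distrib_left sum_divide_distrib)
    also have "\<dots> \<le> s * e + k / (q * s)"
      using s q by (intro add_mono mult_left_mono divide_right_mono sum_f sum_g) simp_all
    finally have "(\<Sum>j<n. 2 * cmod (L2_inner M (E (B j) g) f)) \<le> s * e + k / (q * s)" .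
    moreover have "2 * cmod (\<Sum>j<n. L2_inner M (E (B j) g) f) \<le> (\<Sum>j<n. 2 * cmod (L2_inner M (E (B j) g) f))"
      using norm_sum[of "\<lambda>j. L2_inner M (E (B j) g) f" "{..<n}"] by (simp add: sum_distrib_left[symmetric])
    ultimately show ?thesis
      by linarith
  qed
  \<comment> \<open>Strong countable additivity carries the bound from finite sums of pieces to the
    whole projection.\<close>
  define d where "d n = L2_norm M (\<lambda>x. E {0<..l} g x - (\<Sum>j<n. E (B j) g x))" for n :: nat
  have d: "d \<longlonglongrightarrow> 0"
    using E_UN[of B g] disj g by (simp add: UN d_def[abs_def] image_subset_iff)
  have "2 * cmod (L2_inner M (E {0<..l} g) f) \<le> s * e + k / (q * s) + 2 * (d n * L2_norm M f)" for n
  proof -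
    have L2: "E {0<..l} g \<in> L2 M" "(\<lambda>x. \<Sum>j<n. E (B j) g x) \<in> L2 M"
      by (intro L2_sum E_L2 g; simp)+
    have "L2_inner M (\<lambda>x. E {0<..l} g x - (\<Sum>j<n. E (B j) g x)) f =
        L2_inner M (E {0<..l} g) f - (\<Sum>j<n. L2_inner M (E (B j) g) f)"
      using L2 f g by (simp add: L2_inner_diff L2_inner_sum E_L2)
    moreover have "cmod (L2_inner M (\<lambda>x. E {0<..l} g x - (\<Sum>j<n. E (B j) g x)) f) \<le> d n * L2_norm M f"
      unfolding d_def by (intro L2_Cauchy_Schwarz L2_diff L2 f)
    ultimately show ?thesis
      using sum_le[of n] norm_triangle_sub[of "L2_inner M (E {0<..l} g) f" "\<Sum>j<n. L2_inner M (E (B j) g) f"]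
      by simp
  qed
  moreover have "(\<lambda>n. s * e + k / (q * s) + 2 * (d n * L2_norm M f)) \<longlonglongrightarrow> s * e + k / (q * s) + 2 * (0 * L2_norm M f)"
    by (intro tendsto_intros d)
  ultimately show ?thesis
    using LIMSEQ_le_const[of _ "s * e + k / (q * s) + 2 * (0 * L2_norm M f)"] by simp
qed

text \<open>After \<open>q\<close> has tended to 1, the right-hand side is minimised over
  \<open>s\<close>, at the square root of k/e.\<close>

lemma inner_E_le:
  assumes f: "f \<in> L2 M" and g: "g \<in> L2 M" and l: "0 < l"
    and e: "0 < e" "(\<integral>\<^sup>+t. ennreal t \<partial>\<mu> f) \<le> ennreal e"
    and k: "0 \<le> k" "(\<integral>\<^sup>+t\<in>{0<..l}. ennreal (1 / t) \<partial>\<mu> g) \<le> ennreal k"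
  shows "cmod (L2_inner M (E {0<..l} g) f) \<le> sqrt (e * k)"
proof -
  let ?z = "cmod (L2_inner M (E {0<..l} g) f)"
  have le: "2 * ?z \<le> s * e + k / s" if s: "0 < s" for s
  proof (rule tendsto_lowerbound)
    show "((\<lambda>q. s * e + k / (q * s)) \<longlongrightarrow> s * e + k / s) (at_left 1)"
      using s by (auto intro!: tendsto_eq_intros)
    have "\<forall>\<^sub>F q in at_left (1::real). q \<in> {0<..<1}"
      by (rule eventually_at_left_real) simp
    then show "\<forall>\<^sub>F q in at_left 1. 2 * ?z \<le> s * e + k / (q * s)"
      by eventually_elim (use f g l s e k in \<open>auto intro!: inner_E_le_partition\<close>)
  qed simp
  show ?thesis
  proof (cases "k = 0")
    \<comment> \<open>For \<open>k = 0\<close> no positive \<open>s\<close> attains the infimum, so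
      \<open>s\<close> is taken arbitrarily small.\<close>
    case True
    have "?z \<le> 0"
    proof (rule field_le_epsilon)
      fix d :: real assume "0 < d"
      then show "?z \<le> 0 + d"
        using le[of "d / e"] e True by simp
    qed
    then show ?thesis
      by (simp add: True)
  next
    case False
    with k have k: "0 < k"
      by simp
    define s where "s = sqrt k / sqrt e"
    have s: "0 < s"
      using e k by (simp add: s_def)
    have "s * e = sqrt k * (e / sqrt e)" "k / s = (k / sqrt k) * sqrt e"
      by (simp_all add: s_def)
    then have "s * e + k / s = 2 * sqrt (e * k)"
      using e k by (simp add: real_div_sqrt real_sqrt_mult)
    with le[OF s] show ?thesis
      by simp
  qed
qed

text \<open>The bound by \<open>green_bound\<close> is uniform over test functions, so duality
  converts the pairing estimate into a pointwise one.\<close>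

lemma AE_projection_le:
  assumes f: "f \<in> L2 M" and l: "0 < l"
    and e: "0 < e" "(\<integral>\<^sup>+t. ennreal t \<partial>\<mu> f) \<le> ennreal e"
    and k: "0 \<le> k" "green_bound M E l \<le> ennreal k"
  shows "AE x in M. cmod (E {0<..l} f x) \<le> sqrt (e * k)"
proof (rule AE_norm_le_dual)
  fix g assume g: "g \<in> L1_ball M"
  then have L2: "g \<in> L2 M"
    by (simp add: L1_ball_def)
  have "(\<integral>\<^sup>+t\<in>{0<..l}. ennreal (1 / t) \<partial>\<mu> g) \<le> green_bound M E l"
    unfolding green_bound_def using g by (rule SUP_upper)
  also note k(2)
  finally have "cmod (L2_inner M (E {0<..l} g) f) \<le> sqrt (e * k)"
    by (intro inner_E_le f L2 l e k)
  moreover have "L2_inner M (E {0<..l} f) g = cnj (L2_inner M (E {0<..l} g) f)"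
    using E_symm[of "{0<..l}" f g] f L2 by (simp add: L2_inner_commute[of M f])
  ultimately show "cmod (L2_inner M (E {0<..l} f) g) \<le> sqrt (e * k)"
    by simp
qed (use f e k in \<open>simp_all add: E_L2\<close>)

end

section \<open>The discretized layer cake formula\<close>

text \<open>Counting grid points from \<open>j = 1\<close> uses right endpoints, so the Riemann sum
  never exceeds the length of the interval.\<close>

lemma card_multiples_less:
  fixes t :: real
  assumes m: "0 < m"
  shows "real (card {j \<in> {1..N}. real j / real m < t}) / real m \<le> max 0 t"
proof -
  have "{j \<in> {1..N}. real j / real m < t} \<subseteq> {1..nat \<lfloor>real m * t\<rfloor>}"
  proof
    fix j assume "j \<in> {j \<in> {1..N}. real j / real m < t}"
    then have j: "1 \<le> j" "real j < real m * t"
      using m by (simp_all add: field_simps)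
    then have "int j \<le> \<lfloor>real m * t\<rfloor>"
      by (simp add: le_floor_iff)
    then show "j \<in> {1..nat \<lfloor>real m * t\<rfloor>}"
      using j by simp
  qed
  then have "card {j \<in> {1..N}. real j / real m < t} \<le> nat \<lfloor>real m * t\<rfloor>"
    using card_mono[of "{1..nat \<lfloor>real m * t\<rfloor>}"] by simp
  then have "real (card {j \<in> {1..N}. real j / real m < t}) \<le> real (nat \<lfloor>real m * t\<rfloor>)"
    by simp
  also have "\<dots> \<le> max 0 (real m * t)"
    by (simp add: max_def)
  also have "\<dots> = real m * max 0 t"
    using m by (simp add: max_def zero_le_mult_iff)
  finally show ?thesis
    using m by (simp add: field_simps)
qed

text \<open>The \<open>m * m\<close> grid points of spacing 1/m reach up to \<open>m\<close>, whence
  the bound on \<open>l\<close>; rounding down loses at most one mesh width.\<close>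

lemma card_multiples_le:
  fixes l :: real
  assumes m: "0 < m" and l: "0 \<le> l" "l \<le> real m"
  shows "l - 1 / real m \<le> real (card {j \<in> {1..m * m}. real j / real m \<le> l}) / real m"
proof -
  have "{1..nat \<lfloor>real m * l\<rfloor>} \<subseteq> {j \<in> {1..m * m}. real j / real m \<le> l}"
  proof
    fix j assume "j \<in> {1..nat \<lfloor>real m * l\<rfloor>}"
    then have "1 \<le> j" "int j \<le> \<lfloor>real m * l\<rfloor>"
      by auto
    then have j: "1 \<le> j" "real j \<le> real m * l"
      by (simp_all add: le_floor_iff)
    moreover have "real m * l \<le> real (m * m)"
      using l by (simp add: mult_left_mono)
    ultimately have "j \<le> m * m"
      by linarith
    with j show "j \<in> {j \<in> {1..m * m}. real j / real m \<le> l}"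
      using m by (simp add: field_simps)
  qed
  then have "nat \<lfloor>real m * l\<rfloor> \<le> card {j \<in> {1..m * m}. real j / real m \<le> l}"
    using card_mono[of "{j \<in> {1..m * m}. real j / real m \<le> l}" "{1..nat \<lfloor>real m * l\<rfloor>}"] by simp
  moreover have "real m * l - 1 \<le> real (nat \<lfloor>real m * l\<rfloor>)"
    by linarith
  ultimately have "real m * l - 1 \<le> real (card {j \<in> {1..m * m}. real j / real m \<le> l})"
    by linarith
  then have "(real m * l - 1) / real m \<le> real (card {j \<in> {1..m * m}. real j / real m \<le> l}) / real m"
    by (rule divide_right_mono) simp
  moreover have "(real m * l - 1) / real m = l - 1 / real m"
    using m by (simp add: field_simps)
  ultimately show ?thesis
    by simp
qed

lemma sum_indicator_eq_card:
  "(\<Sum>j\<in>{1..N::nat}. ennreal (1 / real m) * indicator (A j) x) =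
    ennreal (real (card {j \<in> {1..N}. x \<in> A j}) / real m)"
proof -
  have "(\<Sum>j\<in>{1..N}. ennreal (1 / real m) * indicator (A j) x) =
      (\<Sum>j\<in>{j \<in> {1..N}. x \<in> A j}. ennreal (1 / real m))"
    by (rule sum.mono_neutral_cong_right) auto
  also have "\<dots> = ennreal (\<Sum>j\<in>{j \<in> {1..N}. x \<in> A j}. 1 / real m)"
    by (rule sum_ennreal) simp
  finally show ?thesis
    by simp
qed

context pvm
begin

lemma nn_integral_tail_le:
  assumes f: "f \<in> L2 M" and null: "emeasure (\<mu> f) {..0} = 0"
    and e: "0 < e" "(\<integral>\<^sup>+t. ennreal t \<partial>\<mu> f) \<le> ennreal e" and q: "0 < q"
  shows "(\<integral>\<^sup>+x. ennreal ((cmod (f x))\<^sup>2 / 4) *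
      indicator {x. ennreal (4 * e) * green_bound M E q \<le> ennreal ((cmod (f x))\<^sup>2)} x \<partial>M)
    \<le> emeasure (\<mu> f) {q<..}"
proof (cases "green_bound M E q")
  \<comment> \<open>No finite value dominates an infinite one, so the indicator vanishes.\<close>
  case top
  then show ?thesis
    using e by (simp add: ennreal_mult_eq_top_iff top_unique)
next
  case (real k)
  let ?P = "E {0<..q} f"
  have P: "?P \<in> L2 M"
    by (simp add: E_L2 f)
  have "AE x in M. cmod (?P x) \<le> sqrt (e * k)"
    using real by (intro AE_projection_le f q e) simp_all
  then have "AE x in M. ennreal ((cmod (f x))\<^sup>2 / 4) *
      indicator {x. ennreal (4 * e) * green_bound M E q \<le> ennreal ((cmod (f x))\<^sup>2)} x
      \<le> ennreal ((cmod (f x - ?P x))\<^sup>2)"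
  proof eventually_elim
    case (elim x)
    have "(cmod (f x))\<^sup>2 / 4 \<le> (cmod (f x - ?P x))\<^sup>2"
      if "ennreal (4 * e) * green_bound M E q \<le> ennreal ((cmod (f x))\<^sup>2)"
    proof -
      have "4 * e * k \<le> (cmod (f x))\<^sup>2"
        using that real e by (simp add: ennreal_mult'[symmetric])
      then have "sqrt (4 * e * k) \<le> cmod (f x)"
        using real_sqrt_le_mono by fastforce
      then have "2 * sqrt (e * k) \<le> cmod (f x)"
        by (simp add: real_sqrt_mult mult.assoc)
      with elim have "cmod (f x) / 2 \<le> cmod (f x) - cmod (?P x)"
        by linarith
      also have "\<dots> \<le> cmod (f x - ?P x)"
        by (rule norm_triangle_ineq2)
      finally have "(cmod (f x) / 2)\<^sup>2 \<le> (cmod (f x - ?P x))\<^sup>2"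
        by (rule power_mono) simp
      then show ?thesis
        by (simp add: power_divide)
    qed
    then show ?case
      by (auto intro: ennreal_leI split: split_indicator)
  qed
  then have "(\<integral>\<^sup>+x. ennreal ((cmod (f x))\<^sup>2 / 4) *
      indicator {x. ennreal (4 * e) * green_bound M E q \<le> ennreal ((cmod (f x))\<^sup>2)} x \<partial>M)
      \<le> (\<integral>\<^sup>+x. ennreal ((cmod (f x - ?P x))\<^sup>2) \<partial>M)"
    by (rule nn_integral_mono_AE)
  also have "\<dots> = ennreal ((L2_norm M (\<lambda>x. f x - ?P x))\<^sup>2)"
    using L2_integrable_power2[OF L2_diff[OF f P]]
    by (simp add: nn_integral_eq_integral L2_norm_def)
  \<comment> \<open>Pythagoras gives the mass outside \<open>{0<..q}\<close>, which is that of
    \<open>{q<..}\<close> because \<open>{..0}\<close> is null.\<close>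
  also have "(L2_norm M (\<lambda>x. f x - ?P x))\<^sup>2 = (L2_norm M f)\<^sup>2 - (L2_norm M ?P)\<^sup>2"
    using inner_E_self[of "{0<..q}" f] f P
    by (simp add: L2_norm_diff_power2 L2_inner_commute[of M f] del: of_real_power)
  also have "\<dots> = measure (\<mu> f) UNIV - measure (\<mu> f) {0<..q}"
    by (simp add: measure_\<mu> f norm_E_UNIV)
  also have "\<dots> = measure (\<mu> f) {q<..}"
  proof -
    interpret finite_measure "\<mu> f"
      by (rule finite_\<mu>) fact
    have "measure (\<mu> f) UNIV = measure (\<mu> f) ({..0} \<union> ({0<..q} \<union> {q<..}))"
      using q by (intro arg_cong[of _ _ "measure (\<mu> f)"]) auto
    also have "\<dots> = measure (\<mu> f) {..0} + measure (\<mu> f) ({0<..q} \<union> {q<..})"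
      using q by (intro finite_measure_Union) auto
    also have "measure (\<mu> f) ({0<..q} \<union> {q<..}) = measure (\<mu> f) {0<..q} + measure (\<mu> f) {q<..}"
      by (intro finite_measure_Union) auto
    also have "measure (\<mu> f) {..0} = 0"
      by (simp add: measure_def null)
    finally show ?thesis
      by simp
  qed
  finally show ?thesis
    using f by (simp add: emeasure_\<mu> measure_\<mu>)
qed

text \<open>For each x, \<open>S n x\<close> is a Riemann sum for the length of the set of
  thresholds q with \<open>x \<in> A q\<close>. The layer cake estimate bounds its weighted integral
  by \<open>e\<close>, and its lower limit dominates the right inverse.\<close>

lemma H_fun_integral_le:
  assumes f: "f \<in> L2 M" and null: "emeasure (\<mu> f) {..0} = 0"
    and e: "0 < e" "(\<integral>\<^sup>+t. ennreal t \<partial>\<mu> f) \<le> ennreal e"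
    and G: "\<And>l. 0 < l \<Longrightarrow> green_bound M E l \<le> G l"
  shows "(\<integral>\<^sup>+x. H_fun G (ennreal ((cmod (f x))\<^sup>2 / (4 * e))) \<partial>M) \<le> 1"
proof -
  have [measurable]: "f \<in> borel_measurable M"
    using f by (rule L2_measurable)
  define A where "A q = {x. ennreal (4 * e) * green_bound M E q \<le> ennreal ((cmod (f x))\<^sup>2)}" for q
  define m where "m n = Suc n" for n
  define S where "S n x = (\<Sum>j\<in>{1..m n * m n}. ennreal (1 / real (m n)) * indicator (A (real j / real (m n))) x)" for n x
  define w where "w x = ennreal ((cmod (f x))\<^sup>2 / 4)" for x
  have [measurable]: "w \<in> borel_measurable M"
    by (simp add: w_def[abs_def])
  have A [measurable]: "(\<lambda>x. indicator (A q) x :: ennreal) \<in> borel_measurable M" for q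
    unfolding A_def indicator_def by measurable
  have S [measurable]: "S n \<in> borel_measurable M" for n
    unfolding S_def[abs_def] by measurable
  have S_le: "(\<integral>\<^sup>+x. w x * S n x \<partial>M) \<le> ennreal e" for n
  proof -
    have m: "0 < m n"
      by (simp add: m_def)
    have "(\<integral>\<^sup>+x. w x * S n x \<partial>M) = (\<integral>\<^sup>+x. (\<Sum>j\<in>{1..m n * m n}. ennreal (1 / real (m n)) * (w x * indicator (A (real j / real (m n))) x)) \<partial>M)"
      unfolding S_def sum_distrib_left by (simp only: mult.left_commute)
    also have "\<dots> = (\<Sum>j\<in>{1..m n * m n}. ennreal (1 / real (m n)) * (\<integral>\<^sup>+x. w x * indicator (A (real j / real (m n))) x \<partial>M))"
      by (subst nn_integral_sum) (simp_all add: nn_integral_cmult)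
    also have "\<dots> \<le> (\<Sum>j\<in>{1..m n * m n}. ennreal (1 / real (m n)) * emeasure (\<mu> f) {real j / real (m n)<..})"
      unfolding w_def A_def using m
      by (intro sum_mono mult_left_mono nn_integral_tail_le f null e) simp_all
    also have "\<dots> = (\<integral>\<^sup>+t. (\<Sum>j\<in>{1..m n * m n}. ennreal (1 / real (m n)) * indicator {real j / real (m n)<..} t) \<partial>\<mu> f)"
      by (subst nn_integral_sum) (simp_all add: nn_integral_cmult)
    also have "\<dots> \<le> (\<integral>\<^sup>+t. ennreal t \<partial>\<mu> f)"
    proof (rule nn_integral_mono)
      fix t
      have t: "ennreal (max 0 t) = ennreal t"
        by (simp add: max_def ennreal_neg)
      show "(\<Sum>j\<in>{1..m n * m n}. ennreal (1 / real (m n)) * indicator {real j / real (m n)<..} t) \<le> ennreal t"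
        using ennreal_leI[OF card_multiples_less[OF m, of "m n * m n" t]]
        by (simp only: sum_indicator_eq_card greaterThan_iff t)
    qed
    also note e(2)
    finally show ?thesis .
  qed
  have inverse_le: "right_inverse G (ennreal ((cmod (f x))\<^sup>2 / (4 * e))) \<le> liminf (\<lambda>n. S n x)" for x
    unfolding right_inverse_def
  proof (rule Sup_least, clarify)
    fix l :: real assume l: "0 \<le> l" and Gl: "G l \<le> ennreal ((cmod (f x))\<^sup>2 / (4 * e))"
    show "ennreal l \<le> liminf (\<lambda>n. S n x)"
    proof (cases "l = 0")
      case False
      have "ennreal (4 * e) * green_bound M E l \<le> ennreal (4 * e) * ennreal ((cmod (f x))\<^sup>2 / (4 * e))"
        using l False by (intro mult_left_mono order_trans[OF G Gl]) simp_all
      also have "\<dots> = ennreal ((cmod (f x))\<^sup>2)"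
        using e by (simp add: ennreal_mult'[symmetric])
      \<comment> \<open>Monotonicity of \<open>green_bound\<close> makes the admissible thresholds
        an initial segment, so all grid points up to \<open>l\<close> are counted.\<close>
      finally have xA: "x \<in> A q" if "q \<le> l" for q
        unfolding A_def using that
        by (auto intro: order_trans[OF mult_left_mono[OF green_bound_mono]])
      have "ennreal (l - 1 / real (m n)) \<le> S n x" if n: "l \<le> real n" for n
      proof -
        have m: "0 < m n" "l \<le> real (m n)"
          using n by (simp_all add: m_def)
        have "card {j \<in> {1..m n * m n}. real j / real (m n) \<le> l}
            \<le> card {j \<in> {1..m n * m n}. x \<in> A (real j / real (m n))}"
          using xA by (intro card_mono) auto
        then have "real (card {j \<in> {1..m n * m n}. real j / real (m n) \<le> l}) / real (m n)
            \<le> real (card {j \<in> {1..m n * m n}. x \<in> A (real j / real (m n))}) / real (m n)"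
          by (intro divide_right_mono) simp_all
        with card_multiples_le[OF m(1) l m(2)]
        have "l - 1 / real (m n) \<le> real (card {j \<in> {1..m n * m n}. x \<in> A (real j / real (m n))}) / real (m n)"
          by linarith
        then show ?thesis
          unfolding S_def sum_indicator_eq_card by (rule ennreal_leI)
      qed
      then have "\<forall>\<^sub>F n in sequentially. ennreal (l - 1 / real (m n)) \<le> S n x"
        using eventually_ge_at_top[of "nat \<lceil>l\<rceil>"]
        by (auto elim!: eventually_mono simp: nat_le_iff ceiling_le_iff)
      then have "liminf (\<lambda>n. ennreal (l - 1 / real (m n))) \<le> liminf (\<lambda>n. S n x)"
        by (rule Liminf_mono)
      moreover have "(\<lambda>n. l - 1 / real (m n)) \<longlonglongrightarrow> l - 0"
        unfolding m_def by (intro tendsto_intros LIMSEQ_Suc lim_1_over_n)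
      then have "(\<lambda>n. ennreal (l - 1 / real (m n))) \<longlonglongrightarrow> ennreal l"
        by (intro tendsto_ennrealI) simp
      then have "liminf (\<lambda>n. ennreal (l - 1 / real (m n))) = ennreal l"
        by (intro lim_imp_Liminf) simp_all
      ultimately show ?thesis
        by simp
    qed simp
  qed
  have "(\<integral>\<^sup>+x. H_fun G (ennreal ((cmod (f x))\<^sup>2 / (4 * e))) \<partial>M) \<le>
      (\<integral>\<^sup>+x. ennreal (1 / e) * (w x * liminf (\<lambda>n. S n x)) \<partial>M)"
  proof (rule nn_integral_mono)
    fix x
    have "ennreal ((cmod (f x))\<^sup>2 / (4 * e)) = ennreal (1 / e) * w x"
      using e by (simp add: w_def ennreal_mult'[symmetric])
    then show "H_fun G (ennreal ((cmod (f x))\<^sup>2 / (4 * e))) \<le> ennreal (1 / e) * (w x * liminf (\<lambda>n. S n x))"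
      unfolding H_fun_def using mult_left_mono[OF inverse_le[of x], of "ennreal (1 / e) * w x"]
      by (simp add: mult.assoc)
  qed
  also have "\<dots> = ennreal (1 / e) * (\<integral>\<^sup>+x. w x * liminf (\<lambda>n. S n x) \<partial>M)"
    by (simp add: nn_integral_cmult)
  \<comment> \<open>Absorbing \<open>w\<close> into the measure lets Fatou's lemma act on
    \<open>S n\<close> alone.\<close>
  also have "(\<integral>\<^sup>+x. w x * liminf (\<lambda>n. S n x) \<partial>M) = (\<integral>\<^sup>+x. liminf (\<lambda>n. S n x) \<partial>density M w)"
    by (simp add: nn_integral_density)
  also have "\<dots> \<le> liminf (\<lambda>n. \<integral>\<^sup>+x. S n x \<partial>density M w)"
    by (intro nn_integral_liminf) simp
  also have "\<dots> = liminf (\<lambda>n. \<integral>\<^sup>+x. w x * S n x \<partial>M)"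
    by (simp add: nn_integral_density)
  also have "\<dots> \<le> liminf (\<lambda>n. ennreal e)"
    by (intro Liminf_mono always_eventually allI S_le)
  also have "\<dots> = ennreal e"
    by (simp add: Liminf_const)
  also have "ennreal (1 / e) * ennreal e = 1"
    using e by (simp add: ennreal_mult'[symmetric])
  finally show ?thesis
    by (simp add: mult_left_mono)
qed

end

section \<open>The inequality for vectors orthogonal to the kernel\<close>

theorem theorem1p1:
  fixes M :: "'a measure"
    and A :: "'a operator"
    and E :: "real set \<Rightarrow> ('a \<Rightarrow> complex) \<Rightarrow> ('a \<Rightarrow> complex)"
    and F G :: "real \<Rightarrow> ennreal"
    and f :: "'a \<Rightarrow> complex"
  assumes "sigma_finite_measure M"
    and "self_adjoint M A" and "positive_operator M A"
    and "spectral_resolution M A E"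
    and F_def: "F = spectral_F M E" and "\<forall>l>0. F l < \<infinity>"
    and G_def: "G = stieltjes_G F" and "\<forall>l>0. G l < \<infinity>"
    and "f \<in> orth_kernel M A" and "\<not> eq_ae M f (\<lambda>x. 0)"
  shows "(\<integral>\<^sup>+ x. H_fun G (ennreal ((cmod (f x))\<^sup>2) / (4 * energy M E f)) \<partial>M) \<le> 1"
proof (cases "energy M E f")
  case top
  \<comment> \<open>Division by infinity gives 0, and H(0) = 0 even if the right inverse is infinite
    there, as 0 times infinity is 0 in \<open>ennreal\<close>.\<close>
  then show ?thesis
    by (simp add: H_fun_def ennreal_mult_top)
next
  case (real e)
  interpret pvm M E
    using assms(4) by unfold_locales (simp add: spectral_resolution_def)
  have A: "A = spectral_integral M E (\<lambda>t. t)"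
    using assms(4) by (simp add: spectral_resolution_def)
  have f: "f \<in> L2 M"
    using assms(9) by (simp add: orth_kernel_def)
  have "emeasure (\<mu> f) {..<0} = 0"
    using assms(2,3) A f by (intro negative_spectrum_null) (auto simp: self_adjoint_def)
  moreover have "emeasure (\<mu> f) {0} = 0"
    using A assms(9) by (rule zero_spectrum_null)
  ultimately have "{..<0} \<union> {0} \<in> null_sets (\<mu> f)"
    by (intro null_sets.Un null_setsI) simp_all
  moreover have "{..<0} \<union> {0} = {..0 :: real}"
    by auto
  ultimately have "{..0} \<in> null_sets (\<mu> f)"
    by (simp only:)
  then have null: "emeasure (\<mu> f) {..0} = 0"
    by (rule null_setsD1)
  have int: "(\<integral>\<^sup>+t. ennreal t \<partial>\<mu> f) \<le> ennreal e"
    using nn_integral_le_energy[of f] real by simp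
  \<comment> \<open>Zero energy would concentrate the spectral measure on the null set
    \<open>{..0}\<close> and force \<open>f\<close> to vanish.\<close>
  have "e \<noteq> 0"
  proof
    assume "e = 0"
    with int have "(\<integral>\<^sup>+t. ennreal t \<partial>\<mu> f) = 0"
      by simp
    then have "AE t in \<mu> f. ennreal t = 0"
      by (subst (asm) nn_integral_0_iff_AE) simp_all
    moreover have "AE t in \<mu> f. t \<notin> {..0}"
      using null by (intro AE_not_in null_setsI) simp_all
    ultimately have "AE t in \<mu> f. t \<notin> UNIV"
      by eventually_elim (simp add: ennreal_eq_0_iff)
    then have "UNIV \<in> null_sets (\<mu> f)"
      by (subst AE_iff_null_sets) simp_all
    then have "L2_norm M f = 0"
      by (simp add: null_sets_def emeasure_\<mu> f norm_E_UNIV)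
    with assms(10) f show False
      by (simp add: L2_norm_eq_0_iff)
  qed
  with real have e: "0 < e"
    by simp
  have "ennreal ((cmod (f x))\<^sup>2) / (4 * energy M E f) = ennreal ((cmod (f x))\<^sup>2 / (4 * e))" for x
  proof -
    have "4 * energy M E f = ennreal (4 * e)"
      using real by (simp add: ennreal_mult)
    then show ?thesis
      using e by (simp add: divide_ennreal)
  qed
  moreover have "green_bound M E l \<le> G l" if "0 < l" for l
    using green_bound_le_stieltjes_G[OF that] by (simp add: F_def G_def)
  ultimately show ?thesis
    using H_fun_integral_le[OF f null e int, of G] by simp
qed

end
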